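(* Let $\mathbf{P}_N$, $N\in\mathbb{N}$, be laws on $\mathbb{R}^{[N]}$ built as in the Regeneration Construction below from regeneration laws $(p_N)$, bulk excursion laws $(P_t^{\mathrm{bulk}})_{t\in\mathbb{N}}$ and final excursion laws $(P_t^{\mathrm{fin}})_{t\in\mathbb{N}}$. Then the diffusive rescalings $(\mathbf{P}_N\circ\mathcal{R}_N^{-1})_{N\in\mathbb{N}}$ are tight in $C([0,1])$ for every choice of the regeneration laws $(p_N)_{N\in\mathbb{N}}$ if and only if both of the following hold: (1) $(P_t^{\mathrm{bulk}}\circ\mathcal{R}_t^{-1})_{t\in\mathbb{N}}$ and $(P_t^{\mathrm{fin}}\circ\mathcal{R}_t^{-1})_{t\in\mathbb{N}}$ are tight in $C([0,1])$; (2) $\displaystyle \sup_{t\in\mathbb{N}} P_t^{\mathrm{bulk}}\Big(\frac{\max_{0\le i\le t}|x_i|}{\sqrt t}>a\Big)=o\Big(\frac1{a^2}\Big)$ as $a\to\infty$.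
   Context: For $t\in\mathbb{N}$, $[t]:=\{0,1,\dots,t\}$ and $\mathbb{R}^{[t]}:=\{x=(x_0,\dots,x_t):x_i\in\mathbb{R}\}$. Ingredients: a regeneration law $p_N$, a probability on subsets of $[N]$ containing $0$; bulk excursion laws $P_t^{\mathrm{bulk}}$, probabilities on $\mathbb{R}^{[t]}$ with $P_t^{\mathrm{bulk}}(x_0=x_t=0)=1$; final excursion laws $P_t^{\mathrm{fin}}$, probabilities on $\mathbb{R}^{[t]}$ with $P_t^{\mathrm{fin}}(x_0=0)=1$. Regeneration Construction: $\mathbf{P}_N$ is the law on $\mathbb{R}^{[N]}$ of the path obtained by (i) sampling $0=:t_1<\dots<t_n\le N$ with probability $p_N(\{t_1,\dots,t_n\})$; (ii) setting $t_{n+1}:=N$ and writing the path as a concatenation of excursions $x^{(i)}:=(x_{t_i},\dots,x_{t_{i+1}})$, $i=1,\dots,n$; (iii) given the epochs, sampling the excursions independently, $x^{(i)}$ with law $P^{\mathrm{bulk}}_{t_{i+1}-t_i}$ for $i=1,\dots,n-1$, and (if $t_n<N$) $x^{(n)}$ with law $P^{\mathrm{fin}}_{N-t_n}$. Diffusive rescaling: $\mathcal{R}_N:\mathbb{R}^{[N]}\to C([0,1])$ maps $x$ to the linear interpolation of the values $x_{Nt}/\sqrt N$ at $t\in\{0,\frac1N,\dots,1\}$. $C([0,1])$ carries the topology of uniform convergence. *)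

theory Defs
  imports "HOL-Analysis.Analysis" "HOL-Probability.Probability" "HOL-Library.Landau_Symbols"
begin

text \<open>Paths in R^[t] are functions nat => real, extensional on {..t};
  laws on R^[t] are measures with the sigma algebra of path_space t.\<close>

definition path_space :: "nat \<Rightarrow> (nat \<Rightarrow> real) measure" where
  "path_space t = PiM {..t} (\<lambda>_. borel)"

definition C01 :: "(real \<Rightarrow> real) metric" where
  "C01 = cfunspace (top_of_set {0..1}) euclidean_metric"

text \<open>Diffusive rescaling R_N: linear interpolation of x_k / sqrt N at k/N, on [0,1].\<close>

definition rescale :: "nat \<Rightarrow> (nat \<Rightarrow> real) \<Rightarrow> (real \<Rightarrow> real)" where
  "rescale N x = restrict (\<lambda>s. let u = s * real N; k = nat \<lfloor>u\<rfloor> in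
       ((real k + 1 - u) * x k + (u - real k) * x (Suc k)) / sqrt (real N)) {0..1}"

definition tight_C01 :: "(nat \<Rightarrow> (nat \<Rightarrow> real) measure) \<Rightarrow> bool" where
  "tight_C01 M \<longleftrightarrow> (\<forall>\<epsilon>>0. \<exists>K. compactin (mtopology_of C01) K \<and>
      (\<forall>n\<ge>1. measure (M n) {x \<in> space (M n). rescale n x \<in> K} \<ge> 1 - \<epsilon>))"

definition regen_law :: "nat \<Rightarrow> nat set pmf \<Rightarrow> bool" where
  "regen_law N p \<longleftrightarrow> (\<forall>S\<in>set_pmf p. 0 \<in> S \<and> S \<subseteq> {..N})"

text \<open>Given epochs S (with 0 in S, S within [N]), the excursion starting at epoch s < N
  ends at the next epoch (bulk excursion) or at N (final excursion).\<close>

definition next_epoch :: "nat \<Rightarrow> nat set \<Rightarrow> nat \<Rightarrow> nat" where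
  "next_epoch N S s = Min ({u \<in> S. s < u} \<union> {N})"

definition exc_law :: "(nat \<Rightarrow> (nat \<Rightarrow> real) measure) \<Rightarrow> (nat \<Rightarrow> (nat \<Rightarrow> real) measure)
    \<Rightarrow> nat \<Rightarrow> nat set \<Rightarrow> nat \<Rightarrow> (nat \<Rightarrow> real) measure" where
  "exc_law Pbulk Pfin N S s =
     (if \<exists>u\<in>S. s < u then Pbulk (next_epoch N S s - s) else Pfin (N - s))"

definition concat_exc :: "nat \<Rightarrow> nat set \<Rightarrow> (nat \<Rightarrow> nat \<Rightarrow> real) \<Rightarrow> (nat \<Rightarrow> real)" where
  "concat_exc N S y = (\<lambda>k. if k = 0 then 0
       else if k \<le> N then (let s = Max {u \<in> S. u < k} in y s (k - s))
       else undefined)"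

definition regen_given_epochs :: "(nat \<Rightarrow> (nat \<Rightarrow> real) measure) \<Rightarrow> (nat \<Rightarrow> (nat \<Rightarrow> real) measure)
    \<Rightarrow> nat \<Rightarrow> nat set \<Rightarrow> (nat \<Rightarrow> real) measure" where
  "regen_given_epochs Pbulk Pfin N S =
     distr (PiM {s \<in> S. s < N} (exc_law Pbulk Pfin N S)) (path_space N) (concat_exc N S)"

definition regen_law_P :: "nat set pmf \<Rightarrow> (nat \<Rightarrow> (nat \<Rightarrow> real) measure) \<Rightarrow> (nat \<Rightarrow> (nat \<Rightarrow> real) measure)
    \<Rightarrow> nat \<Rightarrow> (nat \<Rightarrow> real) measure" where
  "regen_law_P p Pbulk Pfin N = measure_pmf p \<bind> regen_given_epochs Pbulk Pfin N"

end

theory Submission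
  imports Defs "HOL-Complex_Analysis.Great_Picard"
begin

text \<open>
  By Arzela--Ascoli, tightness of the rescaled laws amounts to two bounds on the discrete paths of
  length \<open>n\<close>, uniform in \<open>n\<close>: one on the maximum at scale \<open>sqrt n\<close>, one on the oscillation over time
  windows \<open>\<delta> n\<close>.

  Sufficiency: the oscillation of a concatenated path is at most twice the largest oscillation of an
  excursion. A bulk excursion of length \<open>l\<close> in a path of length \<open>N\<close> is bad with probability at most
  \<open>\<epsilon> l / N\<close>: for \<open>l\<close> small compared with \<open>N\<close> this is the tail condition, and for \<open>l\<close> of order \<open>N\<close> it
  is tightness of the bulk laws. As the lengths add up to at most \<open>N\<close>, a union bound concludes.

  Necessity: paths with a single excursion give tightness of the bulk and final laws. For the tail
  condition take \<open>m = \<lfloor>a\<^sup>2\<rfloor>\<close> independent bulk excursions of equal length \<open>t\<close>: if each exceeds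
  \<open>a sqrt t\<close> with probability \<open>q\<close>, then with probability at least \<open>1 - exp (- q m)\<close> the path oscillates
  by more than \<open>sqrt (m t)\<close> within a window \<open>t\<close>, a fraction \<open>1 / m\<close> of its length, so \<open>q m\<close> must
  tend to \<open>0\<close>.
\<close>

section \<open>Compactness in C([0,1]) and tightness\<close>

text \<open>The exponent 2 in the tail condition is what makes the union bound additive: a level
  \<open>A * sqrt N\<close>, seen by an excursion of length \<open>l\<close>, is
  \<open>b * sqrt l\<close> with \<open>b\<^sup>2 = A\<^sup>2 * N / l\<close>, so a tail
  \<open>\<kappa> / b\<^sup>2\<close> is linear in \<open>l\<close>. The final excursion occurs at
  most once, so for it a small bound without a length factor suffices. Necessity meets a quantifier
  obstacle: tightness yields a window \<delta> that depends on the choice of the regeneration laws,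
  while the construction with equal excursions lets both \<open>t\<close> and \<open>m\<close> vary
  and needs one \<delta> for all of them. One adversarial choice of epochs, made for every
  \<open>N\<close> at once, removes this dependence. A second obstacle is measurability.
  \<open>tight_C01\<close> measures the preimage of a compact set, and \<open>measure\<close> is 0
  on non-measurable sets. Sufficiency therefore builds compact sets whose preimages are measurable,
  and necessity has to cope with an arbitrary compact set.\<close>

lemma rescale_grid:
  assumes "n \<ge> 1" "i \<le> n"
  shows "rescale n x (real i / real n) = x i / sqrt (real n)"
  using assms by (simp add: rescale_def)

text \<open>\<open>k\<close> and \<theta> depend on \<open>s\<close> and \<open>n\<close> only, so
  the value at \<open>s\<close> is one fixed linear combination of coordinates; measurability rests
  on this. The alternative \<open>\<theta> = 0\<close> covers \<open>s = 1\<close>, where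
  \<open>x (Suc n)\<close> lies outside the path but has weight zero.\<close>

lemma rescale_cell:
  assumes "n \<ge> 1" "s \<in> {0..1}"
  obtains k \<theta> where "k \<le> n" "0 \<le> \<theta>" "\<theta> < 1" "\<theta> = 0 \<or> Suc k \<le> n" "s * real n = real k + \<theta>"
    "\<And>x. rescale n x s = (x k + \<theta> * (x (Suc k) - x k)) / sqrt (real n)"
proof -
  define k where "k = nat \<lfloor>s * real n\<rfloor>"
  define \<theta> where "\<theta> = s * real n - real k"
  have s: "0 \<le> s * real n" "s * real n \<le> real n"
    using assms by (auto simp: mult_left_le_one_le)
  have k: "real k = of_int \<lfloor>s * real n\<rfloor>"
    unfolding k_def using s(1) by simp
  have \<theta>: "0 \<le> \<theta>" "\<theta> < 1"
    unfolding \<theta>_def k by linarith+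
  have u: "s * real n = real k + \<theta>" by (simp add: \<theta>_def)
  have "real k \<le> real n" using s \<theta> u by linarith
  moreover have "\<theta> = 0 \<or> Suc k \<le> n"
  proof (cases "\<theta> = 0")
    case False
    then have "real k < real n" using s(2) \<theta> u by linarith
    then show ?thesis by simp
  qed simp
  moreover have "rescale n x s = (x k + \<theta> * (x (Suc k) - x k)) / sqrt (real n)" for x
    using assms(2) by (simp add: rescale_def Let_def k_def[symmetric] \<theta>_def algebra_simps)
  ultimately show ?thesis
    using that[of k \<theta>] \<theta> u by simp
qed

text \<open>Each cell has an increment of at most \<open>2 * B\<close>. The estimate degrades with
  \<open>n\<close> and serves only for the small \<open>n\<close> whose window is shorter than two
  cells.\<close>

lemma rescale_lipschitz:
  assumes n: "n \<ge> 1" and B: "\<And>i. i \<le> n \<Longrightarrow> \<bar>x i\<bar> \<le> B" and s: "s \<in> {0..1}" and t: "t \<in> {0..1}"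
  shows "\<bar>rescale n x s - rescale n x t\<bar> \<le> 2 * B / sqrt (real n) * (real n * \<bar>s - t\<bar>)"
proof -
  have B0: "0 \<le> B" using B[of 0] by linarith
  have diff: "\<bar>x i - x j\<bar> \<le> 2 * B" if "i \<le> n" "j \<le> n" for i j
    using B[OF that(1)] B[OF that(2)] by linarith
  have *: "\<bar>rescale n x s - rescale n x t\<bar> \<le> 2 * B / sqrt (real n) * (real n * (t - s))"
    if s: "s \<in> {0..1}" and t: "t \<in> {0..1}" and "s \<le> t" for s t
  proof -
    obtain k \<theta> where k: "k \<le> n" "0 \<le> \<theta>" "\<theta> < 1" "\<theta> = 0 \<or> Suc k \<le> n" "s * real n = real k + \<theta>"
      "rescale n x s = (x k + \<theta> * (x (Suc k) - x k)) / sqrt (real n)"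
      using rescale_cell[OF n s] by metis
    obtain l \<phi> where l: "l \<le> n" "0 \<le> \<phi>" "\<phi> < 1" "\<phi> = 0 \<or> Suc l \<le> n" "t * real n = real l + \<phi>"
      "rescale n x t = (x l + \<phi> * (x (Suc l) - x l)) / sqrt (real n)"
      using rescale_cell[OF n t] by metis
    have "s * real n \<le> t * real n"
      using \<open>s \<le> t\<close> by (simp add: mult_right_mono)
    then have uv: "real k + \<theta> \<le> real l + \<phi>" using k l by simp
    have "\<bar>(x k + \<theta> * (x (Suc k) - x k)) - (x l + \<phi> * (x (Suc l) - x l))\<bar>
        \<le> 2 * B * ((real l + \<phi>) - (real k + \<theta>))"
    proof (cases "k = l")
      case True
      then have "(x k + \<theta> * (x (Suc k) - x k)) - (x l + \<phi> * (x (Suc l) - x l))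
          = (\<phi> - \<theta>) * (x l - x (Suc l))"
        by (simp add: algebra_simps)
      moreover have "\<bar>(\<phi> - \<theta>) * (x l - x (Suc l))\<bar> \<le> (\<phi> - \<theta>) * (2 * B)"
      proof (cases "\<phi> = 0")
        case True
        then show ?thesis using uv \<open>k = l\<close> k(2) by simp
      next
        case False
        then have "\<bar>x l - x (Suc l)\<bar> \<le> 2 * B" using l diff by simp
        then show ?thesis
          using uv \<open>k = l\<close> by (simp add: abs_mult mult_left_mono)
      qed
      ultimately show ?thesis using \<open>k = l\<close> by (simp add: mult.commute)
    next
      case False
      then have kl: "Suc k \<le> l" using uv k l by linarith
      then have Sk: "Suc k \<le> n" using l by simp
      have 1: "\<bar>(1 - \<theta>) * (x k - x (Suc k))\<bar> \<le> (1 - \<theta>) * (2 * B)"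
        using k diff[OF k(1) Sk] by (simp add: abs_mult mult_left_mono)
      \<comment> \<open>The grid increment is at most \<open>2 * B\<close> outright; it is nonzero
        only if at least one full cell lies in between, so the factor does no harm.\<close>
      have 2: "\<bar>x (Suc k) - x l\<bar> \<le> (real l - real k - 1) * (2 * B)"
      proof (cases "Suc k = l")
        case False
        then have "1 \<le> real l - real k - 1" using kl by linarith
        then have "1 * (2 * B) \<le> (real l - real k - 1) * (2 * B)"
          using B0 by (intro mult_right_mono) auto
        then show ?thesis using diff[OF Sk l(1)] by linarith
      qed auto
      have 3: "\<bar>\<phi> * (x (Suc l) - x l)\<bar> \<le> \<phi> * (2 * B)"
      proof (cases "\<phi> = 0")
        case False
        then have "\<bar>x (Suc l) - x l\<bar> \<le> 2 * B" using l diff by simp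
        then show ?thesis using l by (simp add: abs_mult mult_left_mono)
      qed simp
      have "(x k + \<theta> * (x (Suc k) - x k)) - (x l + \<phi> * (x (Suc l) - x l))
        = (1 - \<theta>) * (x k - x (Suc k)) + (x (Suc k) - x l) - \<phi> * (x (Suc l) - x l)"
        by (simp add: algebra_simps)
      also have "\<bar>\<dots>\<bar> \<le> (1 - \<theta>) * (2 * B) + (real l - real k - 1) * (2 * B) + \<phi> * (2 * B)"
        using 1 2 3 by linarith
      finally show ?thesis by (simp add: algebra_simps)
    qed
    also have "(real l + \<phi>) - (real k + \<theta>) = real n * (t - s)"
      using k l by (simp add: algebra_simps)
    finally show ?thesis
      unfolding k l diff_divide_distrib[symmetric] abs_divide
      using n by (simp add: divide_right_mono)
  qed
  show ?thesis
  proof (cases "s \<le> t")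
    case True
    then show ?thesis using *[OF s t] by simp
  next
    case False
    then show ?thesis using *[OF t s] by (simp add: abs_minus_commute)
  qed
qed

text \<open>Rounding both times down to the grid changes their distance by less than one cell, hence
  the \<open>+ 1\<close>. The factor 3 counts the grid increment and one interpolation correction at
  each end.\<close>

lemma rescale_modulus:
  assumes n: "n \<ge> 1" and s: "s \<in> {0..1}" and t: "t \<in> {0..1}"
    and a: "\<And>i j. i \<le> n \<Longrightarrow> j \<le> n \<Longrightarrow> \<bar>real i - real j\<bar> \<le> d \<Longrightarrow> \<bar>x i - x j\<bar> \<le> a"
    and d: "real n * \<bar>s - t\<bar> + 1 \<le> d"
  shows "\<bar>rescale n x s - rescale n x t\<bar> \<le> 3 * a / sqrt (real n)"
proof -
  obtain k \<theta> where k: "k \<le> n" "0 \<le> \<theta>" "\<theta> < 1" "\<theta> = 0 \<or> Suc k \<le> n" "s * real n = real k + \<theta>"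
    "rescale n x s = (x k + \<theta> * (x (Suc k) - x k)) / sqrt (real n)"
    using rescale_cell[OF n s] by metis
  obtain l \<phi> where l: "l \<le> n" "0 \<le> \<phi>" "\<phi> < 1" "\<phi> = 0 \<or> Suc l \<le> n" "t * real n = real l + \<phi>"
    "rescale n x t = (x l + \<phi> * (x (Suc l) - x l)) / sqrt (real n)"
    using rescale_cell[OF n t] by metis
  have d1: "1 \<le> d"
    using d by (smt (verit) mult_nonneg_nonneg of_nat_0_le_iff)
  then have a0: "0 \<le> a" using a[of 0 0] by simp
  have step: "\<bar>c * (x (Suc i) - x i)\<bar> \<le> a" if "i \<le> n" "0 \<le> c" "c < 1" "c = 0 \<or> Suc i \<le> n" for i c
  proof (cases "c = 0")
    case False
    then have "\<bar>x (Suc i) - x i\<bar> \<le> a" using that d1 by (intro a) auto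
    then have "c * \<bar>x (Suc i) - x i\<bar> \<le> 1 * a"
      using that by (intro mult_mono) auto
    then show ?thesis using that by (simp add: abs_mult)
  qed (use a0 in simp)
  have "real n * \<bar>s - t\<bar> = \<bar>(real k + \<theta>) - (real l + \<phi>)\<bar>"
    unfolding k(5)[symmetric] l(5)[symmetric] left_diff_distrib[symmetric] abs_mult by simp
  then have "\<bar>real k - real l\<bar> \<le> d" using d k l by linarith
  then have "\<bar>x k - x l\<bar> \<le> a" using k l a by simp
  then have "\<bar>(x k + \<theta> * (x (Suc k) - x k)) - (x l + \<phi> * (x (Suc l) - x l))\<bar> \<le> 3 * a"
    using step[OF k(1-4)] step[OF l(1-4)] by linarith
  then show ?thesis
    unfolding k l diff_divide_distrib[symmetric] abs_divide
    using n by (simp add: divide_right_mono)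
qed

lemma rescale_abs_le:
  assumes n: "n \<ge> 1" and s: "s \<in> {0..1}" and B: "\<And>i. i \<le> n \<Longrightarrow> \<bar>x i\<bar> \<le> B"
  shows "\<bar>rescale n x s\<bar> \<le> B / sqrt (real n)"
proof -
  obtain k \<theta> where k: "k \<le> n" "0 \<le> \<theta>" "\<theta> < 1" "\<theta> = 0 \<or> Suc k \<le> n" 
    "rescale n x s = (x k + \<theta> * (x (Suc k) - x k)) / sqrt (real n)"
    using rescale_cell[OF n s] by metis
  have "\<bar>x k + \<theta> * (x (Suc k) - x k)\<bar> \<le> B"
  proof (cases "\<theta> = 0")
    case False
    then have "\<bar>x (Suc k)\<bar> \<le> B" using k B by simp
    moreover have "x k + \<theta> * (x (Suc k) - x k) = (1 - \<theta>) * x k + \<theta> * x (Suc k)"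
      by (simp add: algebra_simps)
    moreover have "\<bar>(1 - \<theta>) * x k\<bar> \<le> (1 - \<theta>) * B" "\<bar>\<theta> * x (Suc k)\<bar> \<le> \<theta> * B"
      using k B calculation(1) by (simp_all add: abs_mult mult_left_mono)
    ultimately have "\<bar>x k + \<theta> * (x (Suc k) - x k)\<bar> \<le> (1 - \<theta>) * B + \<theta> * B"
      by linarith
    then show ?thesis by (simp add: algebra_simps)
  qed (use k B in simp)
  then show ?thesis
    unfolding k abs_divide using n by (simp add: divide_right_mono)
qed

section \<open>Compact subsets of C([0,1]) and moduli of continuity\<close>

lemma mspace_C01:
  "mspace C01 = {f. f \<in> extensional {0..1} \<and> continuous_on {0..1} f}"
  unfolding C01_def by (subst compactin_mspace_cfunspace) (auto simp: compactin_subtopology)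

lemma mdist_C01_le:
  assumes "f \<in> mspace C01" "g \<in> mspace C01"
  shows "mdist C01 f g \<le> a \<longleftrightarrow> (\<forall>s\<in>{0..1}. \<bar>f s - g s\<bar> \<le> a)"
  using assms unfolding C01_def by (subst cfunspace_mdist_le) (auto simp: dist_real_def)

lemma rescale_in_C01:
  assumes n: "n \<ge> 1"
  shows "rescale n x \<in> mspace C01"
proof -
  define B where "B = Max ((\<lambda>i. \<bar>x i\<bar>) ` {..n})"
  have B: "\<bar>x i\<bar> \<le> B" if "i \<le> n" for i
    unfolding B_def using that by (intro Max_ge) auto
  have B0: "B \<ge> 0" using B[of 0] by linarith
  define L where "L = 2 * B / sqrt (real n) * real n"
  have "L-lipschitz_on {0..1} (rescale n x)"
  proof (rule lipschitz_onI)
    show "dist (rescale n x s) (rescale n x t) \<le> L * dist s t" if "s \<in> {0..1}" "t \<in> {0..1}" for s t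
      using rescale_lipschitz[OF n B that] by (simp add: dist_real_def L_def mult.assoc)
    show "0 \<le> L" using B0 by (simp add: L_def)
  qed
  then have "continuous_on {0..1} (rescale n x)"
    by (rule lipschitz_on_continuous_on)
  moreover have "rescale n x \<in> extensional {0..1}"
    by (simp add: rescale_def)
  ultimately show ?thesis by (simp add: mspace_C01)
qed

text \<open>The necessity half of Arzela--Ascoli: a bound or a modulus common to a finite net
  carries over to all of \<open>K\<close>, up to the mesh of the net.\<close>

lemma compactin_C01_equibounded:
  assumes K: "compactin (mtopology_of C01) K"
  shows "\<exists>A. \<forall>f\<in>K. \<forall>s\<in>{0..1}. \<bar>f s\<bar> \<le> A"
    and "\<eta> > 0 \<Longrightarrow> \<exists>\<delta>>0. \<forall>f\<in>K. \<forall>s\<in>{0..1}. \<forall>t\<in>{0..1}. \<bar>s - t\<bar> \<le> \<delta> \<longrightarrow> \<bar>f s - f t\<bar> \<le> \<eta>"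
proof -
  interpret C: Metric_space "mspace C01" "mdist C01"
    by (rule Metric_space_mspace_mdist)
  have tb: "C.mtotally_bounded K"
    using C.compactin_imp_mtotally_bounded K unfolding mtopology_of_def by blast
  have net: "\<exists>F. finite F \<and> F \<subseteq> mspace C01 \<and> (\<forall>f\<in>K. \<exists>g\<in>F. \<forall>s\<in>{0..1}. \<bar>g s - f s\<bar> \<le> e)"
    if "e > 0" for e
  proof -
    from tb[unfolded C.mtotally_bounded_def, rule_format, OF \<open>e > 0\<close>]
    obtain F where F: "finite F" "F \<subseteq> K" "K \<subseteq> (\<Union>g\<in>F. C.mball g e)"
      by (elim exE conjE)
    have "K \<subseteq> mspace C01"
      using tb by (rule C.mtotally_bounded_imp_subset)
    then have FC: "F \<subseteq> mspace C01" using F(2) by (rule order_trans[rotated])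
    have "\<exists>g\<in>F. \<forall>s\<in>{0..1}. \<bar>g s - f s\<bar> \<le> e" if "f \<in> K" for f
    proof -
      obtain g where g: "g \<in> F" "f \<in> C.mball g e" using subsetD[OF F(3) \<open>f \<in> K\<close>] by auto
      then have "f \<in> mspace C01" "g \<in> mspace C01" "mdist C01 g f \<le> e"
        by (auto simp: C.in_mball)
      then have "\<forall>s\<in>{0..1}. \<bar>g s - f s\<bar> \<le> e" by (simp add: mdist_C01_le)
      then show ?thesis using g(1) by (rule bexI)
    qed
    then show ?thesis using F(1) FC by (intro exI[of _ F]) simp
  qed
  have unif: "uniformly_continuous_on {0..1} g" if "g \<in> mspace C01" for g
    using that compact_uniformly_continuous[of "{0..1}" g] by (simp add: mspace_C01)
  show "\<exists>A. \<forall>f\<in>K. \<forall>s\<in>{0..1}. \<bar>f s\<bar> \<le> A"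
  proof -
    obtain F where F: "finite F" "F \<subseteq> mspace C01" "\<forall>f\<in>K. \<exists>g\<in>F. \<forall>s\<in>{0..1}. \<bar>g s - f s\<bar> \<le> 1"
      using net[of 1] by auto
    have "\<exists>B. \<forall>s\<in>{0..1}. \<bar>g s\<bar> \<le> B" if "g \<in> F" for g
    proof -
      have "compact (g ` {0..1})"
        using that F by (intro compact_continuous_image) (auto simp: mspace_C01)
      then show ?thesis by (auto dest!: compact_imp_bounded simp: bounded_iff)
    qed
    then obtain B where B: "\<And>g s. g \<in> F \<Longrightarrow> s \<in> {0..1} \<Longrightarrow> \<bar>g s\<bar> \<le> B g"
      by metis
    have "\<bar>f s\<bar> \<le> (\<Sum>g\<in>F. \<bar>B g\<bar>) + 1" if f: "f \<in> K" and s: "s \<in> {0..1}" for f s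
    proof -
      obtain g where g: "g \<in> F" "\<bar>g s - f s\<bar> \<le> 1" using F f s by blast
      have "\<bar>B g\<bar> \<le> (\<Sum>g\<in>F. \<bar>B g\<bar>)"
        using g F(1) by (intro member_le_sum) auto
      then show ?thesis using B[OF g(1) s] g(2) by linarith
    qed
    then show ?thesis by blast
  qed
  show "\<exists>\<delta>>0. \<forall>f\<in>K. \<forall>s\<in>{0..1}. \<forall>t\<in>{0..1}. \<bar>s - t\<bar> \<le> \<delta> \<longrightarrow> \<bar>f s - f t\<bar> \<le> \<eta>" if "\<eta> > 0"
  proof -
    obtain F where F: "finite F" "F \<subseteq> mspace C01" "\<forall>f\<in>K. \<exists>g\<in>F. \<forall>s\<in>{0..1}. \<bar>g s - f s\<bar> \<le> \<eta>/3"
      using net[of "\<eta>/3"] \<open>\<eta> > 0\<close> by auto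
    have "\<exists>\<delta>>0. \<forall>s\<in>{0..1}. \<forall>t\<in>{0..1}. \<bar>s - t\<bar> < \<delta> \<longrightarrow> \<bar>g s - g t\<bar> < \<eta>/3" if "g \<in> F" for g
    proof -
      have "g \<in> mspace C01" "\<eta>/3 > 0" using F(2) that \<open>\<eta> > 0\<close> by auto
      then obtain d where "d > 0" "\<forall>s\<in>{0..1}. \<forall>t\<in>{0..1}. dist t s < d \<longrightarrow> dist (g t) (g s) < \<eta>/3"
        using unif[of g] unfolding uniformly_continuous_on_def by meson
      then show ?thesis by (auto simp: dist_real_def abs_minus_commute)
    qed
    then obtain D where D: "\<And>g. g \<in> F \<Longrightarrow> D g > 0"
      "\<And>g s t. g \<in> F \<Longrightarrow> s \<in> {0..1} \<Longrightarrow> t \<in> {0..1} \<Longrightarrow> \<bar>s - t\<bar> < D g \<Longrightarrow> \<bar>g s - g t\<bar> < \<eta>/3"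
      by metis
    \<comment> \<open>The entry 1 covers an empty net; halving gives the strict inequality that
      \<open>D\<close> asks for.\<close>
    define \<delta> where "\<delta> = Min (insert 1 (D ` F)) / 2"
    have \<delta>: "\<delta> > 0"
      unfolding \<delta>_def using F(1) D(1) by (subst half_gt_zero_iff, subst Min_gr_iff) auto
    have \<delta>D: "\<delta> < D g" if "g \<in> F" for g
    proof -
      have "Min (insert 1 (D ` F)) \<le> D g" using that F(1) by (intro Min_le) auto
      then show ?thesis using \<delta> unfolding \<delta>_def by linarith
    qed
    have "\<bar>f s - f t\<bar> \<le> \<eta>" if f: "f \<in> K" and s: "s \<in> {0..1}" and t: "t \<in> {0..1}" and "\<bar>s - t\<bar> \<le> \<delta>" for f s t
    proof -
      obtain g where g: "g \<in> F" "\<forall>s\<in>{0..1}. \<bar>g s - f s\<bar> \<le> \<eta>/3" using F f by blast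
      have "\<bar>g s - g t\<bar> < \<eta>/3"
        using D(2)[OF g(1) s t] \<delta>D[OF g(1)] \<open>\<bar>s - t\<bar> \<le> \<delta>\<close> by linarith
      moreover have "\<bar>g s - f s\<bar> \<le> \<eta>/3" "\<bar>g t - f t\<bar> \<le> \<eta>/3" using g s t by blast+
      ultimately show ?thesis by linarith
    qed
    then show ?thesis using \<delta> by blast
  qed
qed

text \<open>Rounding down keeps the approximations below \<open>s\<close>, hence inside the unit
  interval.\<close>

lemma rational_approximation_unit_interval:
  fixes s :: real
  assumes s: "s \<in> {0..1}"
  obtains q where "\<And>m. q m \<in> {0..1} \<inter> \<rat>" "q \<longlonglongrightarrow> s"
proof -
  define q where "q = (\<lambda>m. of_int \<lfloor>s * real (Suc m)\<rfloor> / real (Suc m))"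
  have ub: "q m \<le> s" for m
  proof -
    have "of_int \<lfloor>s * real (Suc m)\<rfloor> \<le> s * real (Suc m)" by (rule of_int_floor_le)
    then show ?thesis unfolding q_def by (simp add: divide_le_eq)
  qed
  have lb: "s - 1 / real (Suc m) \<le> q m" for m
  proof -
    have "s * real (Suc m) - 1 \<le> of_int \<lfloor>s * real (Suc m)\<rfloor>" by linarith
    then have "(s * real (Suc m) - 1) / real (Suc m) \<le> q m"
      unfolding q_def by (rule divide_right_mono) simp
    then show ?thesis by (simp add: diff_divide_distrib del: of_nat_Suc)
  qed
  have "q m \<in> {0..1} \<inter> \<rat>" for m
  proof -
    have "0 \<le> s * real (Suc m)" using s by (simp del: of_nat_Suc)
    then have "0 \<le> q m" unfolding q_def by (intro divide_nonneg_nonneg) auto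
    moreover have "q m \<in> \<rat>" unfolding q_def by (intro Rats_divide Rats_of_int Rats_of_nat)
    ultimately show ?thesis using ub[of m] s by auto
  qed
  moreover have "q \<longlonglongrightarrow> s"
  proof (rule tendsto_sandwich)
    have "(\<lambda>m. s - 1 / real (Suc m)) \<longlonglongrightarrow> s - 0"
      by (intro tendsto_intros LIMSEQ_Suc lim_1_over_n)
    then show "(\<lambda>m. s - 1 / real (Suc m)) \<longlonglongrightarrow> s" by simp
  qed (use lb ub in auto)
  ultimately show ?thesis using that by blast
qed

text \<open>Only rational times are tested, so that preimages under \<^const>\<open>rescale\<close> are visibly measurable.\<close>

definition modulus_class :: "real \<Rightarrow> (nat \<Rightarrow> real) \<Rightarrow> (nat \<Rightarrow> real) \<Rightarrow> (real \<Rightarrow> real) set" where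
  "modulus_class A \<delta> c = {f \<in> mspace C01. (\<forall>s\<in>{0..1} \<inter> \<rat>. \<bar>f s\<bar> \<le> A) \<and>
     (\<forall>k. \<forall>s\<in>{0..1} \<inter> \<rat>. \<forall>t\<in>{0..1} \<inter> \<rat>. \<bar>s - t\<bar> < \<delta> k \<longrightarrow> \<bar>f s - f t\<bar> \<le> c k)}"

text \<open>Continuity extends the bounds from rational to all times.\<close>

lemma modulus_classD:
  assumes f: "f \<in> modulus_class A \<delta> c" and s: "s \<in> {0..1}"
  shows "\<bar>f s\<bar> \<le> A"
    and "t \<in> {0..1} \<Longrightarrow> \<bar>s - t\<bar> < \<delta> k \<Longrightarrow> \<bar>f s - f t\<bar> \<le> c k"
proof -
  have lim: "(\<lambda>m. f (q m)) \<longlonglongrightarrow> f u" if "\<And>m. q m \<in> {0..1} \<inter> \<rat>" "q \<longlonglongrightarrow> u" "u \<in> {0..1}" for q u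
    using f that continuous_on_tendsto_compose[of "{0..1}" f q u sequentially]
    by (auto simp: modulus_class_def mspace_C01)
  obtain p where p: "\<And>m. p m \<in> {0..1} \<inter> \<rat>" "p \<longlonglongrightarrow> s"
    using rational_approximation_unit_interval[OF s] by metis
  have "(\<lambda>m. \<bar>f (p m)\<bar>) \<longlonglongrightarrow> \<bar>f s\<bar>"
    by (intro tendsto_rabs lim p s)
  moreover have "\<bar>f (p m)\<bar> \<le> A" for m
    using f p(1)[of m] by (auto simp: modulus_class_def)
  ultimately show "\<bar>f s\<bar> \<le> A"
    by (intro LIMSEQ_le_const2) auto
  show "\<bar>f s - f t\<bar> \<le> c k" if t: "t \<in> {0..1}" and st: "\<bar>s - t\<bar> < \<delta> k"
  proof -
    obtain q where q: "\<And>m. q m \<in> {0..1} \<inter> \<rat>" "q \<longlonglongrightarrow> t"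
      using rational_approximation_unit_interval[OF t] by metis
    have "(\<lambda>m. \<bar>f (p m) - f (q m)\<bar>) \<longlonglongrightarrow> \<bar>f s - f t\<bar>"
      by (intro tendsto_rabs tendsto_diff lim p q s t)
    \<comment> \<open>The condition on \<open>\<bar>s - t\<bar>\<close> is strict, hence open, so
      the rational approximations eventually satisfy it too.\<close>
    moreover have "(\<lambda>m. \<bar>p m - q m\<bar>) \<longlonglongrightarrow> \<bar>s - t\<bar>"
      by (intro tendsto_rabs tendsto_diff p q)
    then have "eventually (\<lambda>m. \<bar>p m - q m\<bar> < \<delta> k) sequentially"
      using st by (rule order_tendstoD)
    then have "eventually (\<lambda>m. \<bar>f (p m) - f (q m)\<bar> \<le> c k) sequentially"
      by eventually_elim (use f p(1) q(1) in \<open>auto simp: modulus_class_def\<close>)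
    ultimately show ?thesis
      by (intro tendsto_upperbound) auto
  qed
qed

text \<open>The sufficiency half of Arzela--Ascoli, in sequential form; the class is closed because
  its conditions survive pointwise limits.\<close>

lemma compactin_modulus_class:
  assumes \<delta>: "\<And>k. \<delta> k > 0" and c: "c \<longlonglongrightarrow> 0"
  shows "compactin (mtopology_of C01) (modulus_class A \<delta> c)"
proof -
  interpret C: Metric_space "mspace C01" "mdist C01"
    by (rule Metric_space_mspace_mdist)
  have "\<exists>l r. l \<in> modulus_class A \<delta> c \<and> strict_mono r \<and> limitin C.mtopology (\<sigma> \<circ> r) l sequentially"
    if \<sigma>: "range \<sigma> \<subseteq> modulus_class A \<delta> c" for \<sigma> :: "nat \<Rightarrow> real \<Rightarrow> real"
  proof -
    have \<sigma>K: "\<sigma> n \<in> modulus_class A \<delta> c" for n using \<sigma> by blast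
    have eq: "\<exists>d>0. \<forall>n t. t \<in> {0..1} \<and> norm (s - t) < d \<longrightarrow> norm (\<sigma> n s - \<sigma> n t) < e"
      if s: "s \<in> {0..1}" and "0 < e" for s e
    proof -
      have "eventually (\<lambda>k. c k < e) sequentially"
        using c \<open>0 < e\<close> by (rule order_tendstoD)
      then obtain k where "c k < e" by (auto simp: eventually_sequentially)
      then show ?thesis
        using modulus_classD(2)[OF \<sigma>K s] \<delta>[of k]
        by (intro exI[of _ "\<delta> k"]) (auto intro: le_less_trans)
    qed
    have bd: "norm (\<sigma> n s) \<le> A" if "s \<in> {0..1}" for n s
      using modulus_classD(1)[OF \<sigma>K that] by simp
    obtain g r where g: "continuous_on {0..1} g" and r: "strict_mono (r :: nat \<Rightarrow> nat)"
      and u: "\<And>e. 0 < e \<Longrightarrow> \<exists>N. \<forall>n s. n \<ge> N \<and> s \<in> {0..1} \<longrightarrow> norm (\<sigma> (r n) s - g s) < e"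
      by (rule Arzela_Ascoli[of "{0..1}" \<sigma> A]) (use bd eq in auto)
    \<comment> \<open>The limit \<open>g\<close> is unspecified off the unit interval, whereas
      points of \<open>C01\<close> are extensional.\<close>
    define l where "l = restrict g {0..1}"
    have lC: "l \<in> mspace C01"
      using g continuous_on_cong[of "{0..1}" "{0..1}" l g] by (simp add: mspace_C01 l_def)
    have pt: "(\<lambda>n. \<sigma> (r n) s) \<longlonglongrightarrow> l s" if "s \<in> {0..1}" for s
    proof (rule LIMSEQ_I)
      fix e :: real assume "0 < e"
      then show "\<exists>N. \<forall>n\<ge>N. norm (\<sigma> (r n) s - l s) < e"
        using u[of e] that by (auto simp: l_def)
    qed
    have "l \<in> modulus_class A \<delta> c"
    proof -
      have "\<bar>l s\<bar> \<le> A" if "s \<in> {0..1} \<inter> \<rat>" for s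
      proof (rule LIMSEQ_le_const2)
        show "(\<lambda>n. \<bar>\<sigma> (r n) s\<bar>) \<longlonglongrightarrow> \<bar>l s\<bar>" using that by (intro tendsto_rabs pt) auto
      qed (use bd that in auto)
      moreover have "\<bar>l s - l t\<bar> \<le> c k"
        if "s \<in> {0..1} \<inter> \<rat>" "t \<in> {0..1} \<inter> \<rat>" "\<bar>s - t\<bar> < \<delta> k" for s t k
      proof (rule LIMSEQ_le_const2)
        show "(\<lambda>n. \<bar>\<sigma> (r n) s - \<sigma> (r n) t\<bar>) \<longlonglongrightarrow> \<bar>l s - l t\<bar>"
          using that by (intro tendsto_rabs tendsto_diff pt) auto
      qed (use that modulus_classD(2)[OF \<sigma>K] in auto)
      ultimately show ?thesis using lC by (simp add: modulus_class_def)
    qed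
    moreover have "limitin C.mtopology (\<sigma> \<circ> r) l sequentially"
    proof -
      have \<sigma>C: "\<sigma> n \<in> mspace C01" for n using \<sigma>K[of n] by (simp add: modulus_class_def)
      have "\<exists>N. \<forall>n\<ge>N. (\<sigma> \<circ> r) n \<in> mspace C01 \<and> mdist C01 ((\<sigma> \<circ> r) n) l < e" if "e > 0" for e
      proof -
        obtain N where N: "\<forall>n s. n \<ge> N \<and> s \<in> {0..1} \<longrightarrow> norm (\<sigma> (r n) s - g s) < e/2"
          using u[of "e/2"] \<open>e > 0\<close> by auto
        have "mdist C01 (\<sigma> (r n)) l \<le> e/2" if "n \<ge> N" for n
          using N that by (subst mdist_C01_le[OF \<sigma>C lC]) (auto simp: l_def intro: less_imp_le)
        then have "mdist C01 (\<sigma> (r n)) l < e" if "n \<ge> N" for n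
          using that \<open>e > 0\<close> by (smt (verit) field_sum_of_halves)
        then show ?thesis using \<sigma>C by auto
      qed
      then show ?thesis using lC by (simp add: C.limit_metric_sequentially)
    qed
    ultimately show ?thesis using r by blast
  qed
  then have "compactin C.mtopology (modulus_class A \<delta> c)"
    by (subst C.compactin_sequentially) (auto simp: modulus_class_def)
  then show ?thesis by (simp add: mtopology_of_def)
qed

section \<open>Measurability and the two bad events\<close>

lemma path_space_component_measurable:
  "i \<le> n \<Longrightarrow> (\<lambda>x. x i) \<in> borel_measurable (path_space n)"
  unfolding path_space_def by (rule measurable_component_singleton) simp

lemma rescale_measurable:
  assumes "n \<ge> 1" "s \<in> {0..1}"
  shows "(\<lambda>x. rescale n x s) \<in> borel_measurable (path_space n)"
proof -
  obtain k \<theta> where k: "k \<le> n" "\<theta> = 0 \<or> Suc k \<le> n"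
    "\<And>x. rescale n x s = (x k + \<theta> * (x (Suc k) - x k)) / sqrt (real n)"
    using rescale_cell[OF assms] by metis
  show ?thesis
  proof (cases "\<theta> = 0")
    case True
    then show ?thesis
      unfolding k using path_space_component_measurable[OF k(1)] by simp
  next
    case False
    then have "(\<lambda>x. x (Suc k)) \<in> borel_measurable (path_space n)"
      using k(2) path_space_component_measurable by blast
    then show ?thesis
      unfolding k using path_space_component_measurable[OF k(1)] by measurable
  qed
qed

lemma rescale_vimage_modulus_class:
  assumes n: "n \<ge> 1"
  shows "{x \<in> space (path_space n). rescale n x \<in> modulus_class A \<delta> c} \<in> sets (path_space n)"
proof -
  have cQ: "countable ({0..1::real} \<inter> \<rat>)"
    using countable_rat by (rule countable_subset[rotated]) blast
  have "{x \<in> space (path_space n). \<forall>s\<in>{0..1} \<inter> \<rat>. \<bar>rescale n x s\<bar> \<le> A} \<in> sets (path_space n)"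
  proof (rule sets.sets_Collect_countable_All'[OF _ cQ])
    fix s :: real assume "s \<in> {0..1} \<inter> \<rat>"
    then have [measurable]: "(\<lambda>x. rescale n x s) \<in> borel_measurable (path_space n)"
      using n by (intro rescale_measurable) auto
    show "{x \<in> space (path_space n). \<bar>rescale n x s\<bar> \<le> A} \<in> sets (path_space n)"
      by measurable
  qed
  moreover have "{x \<in> space (path_space n). \<forall>k. \<forall>s\<in>{0..1} \<inter> \<rat>. \<forall>t\<in>{0..1} \<inter> \<rat>.
      \<bar>s - t\<bar> < \<delta> k \<longrightarrow> \<bar>rescale n x s - rescale n x t\<bar> \<le> c k} \<in> sets (path_space n)"
  proof (intro sets.sets_Collect_countable_All sets.sets_Collect_countable_All'[OF _ cQ])
    fix k and s t :: real assume "s \<in> {0..1} \<inter> \<rat>" "t \<in> {0..1} \<inter> \<rat>"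
    then have [measurable]: "(\<lambda>x. rescale n x s) \<in> borel_measurable (path_space n)"
       "(\<lambda>x. rescale n x t) \<in> borel_measurable (path_space n)"
      using n by (auto intro: rescale_measurable)
    show "{x \<in> space (path_space n). \<bar>s - t\<bar> < \<delta> k \<longrightarrow> \<bar>rescale n x s - rescale n x t\<bar> \<le> c k} \<in> sets (path_space n)"
      by measurable
  qed
  ultimately show ?thesis
    using rescale_in_C01[OF n] unfolding modulus_class_def
    by (simp add: sets.sets_Collect_conj)
qed

definition max_exceeds :: "nat \<Rightarrow> real \<Rightarrow> (nat \<Rightarrow> real) set" where
  "max_exceeds n a = {x \<in> space (path_space n). \<exists>i\<le>n. a < \<bar>x i\<bar>}"

definition osc_exceeds :: "nat \<Rightarrow> real \<Rightarrow> real \<Rightarrow> (nat \<Rightarrow> real) set" where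
  "osc_exceeds n d a =
    {x \<in> space (path_space n). \<exists>i\<le>n. \<exists>j\<le>n. \<bar>real i - real j\<bar> \<le> d \<and> a < \<bar>x i - x j\<bar>}"

lemma max_exceeds_sets [measurable]: "max_exceeds n a \<in> sets (path_space n)"
proof -
  have "{x \<in> space (path_space n). \<exists>i\<in>{..n}. a < \<bar>x i\<bar>} \<in> sets (path_space n)"
  proof (rule sets.sets_Collect_finite_Ex)
    fix i assume "i \<in> {..n}"
    then have [measurable]: "(\<lambda>x. x i) \<in> borel_measurable (path_space n)"
      by (intro path_space_component_measurable) simp
    show "{x \<in> space (path_space n). a < \<bar>x i\<bar>} \<in> sets (path_space n)"
      by measurable
  qed simp
  also have "{x \<in> space (path_space n). \<exists>i\<in>{..n}. a < \<bar>x i\<bar>} = max_exceeds n a"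
    by (auto simp: max_exceeds_def)
  finally show ?thesis .
qed

lemma osc_exceeds_sets [measurable]: "osc_exceeds n d a \<in> sets (path_space n)"
proof -
  have "{x \<in> space (path_space n). \<exists>i\<in>{..n}. \<exists>j\<in>{..n}. \<bar>real i - real j\<bar> \<le> d \<and> a < \<bar>x i - x j\<bar>}
      \<in> sets (path_space n)"
  proof (intro sets.sets_Collect_finite_Ex)
    fix i j assume "i \<in> {..n}" "j \<in> {..n}"
    then have [measurable]: "(\<lambda>x. x i) \<in> borel_measurable (path_space n)"
      "(\<lambda>x. x j) \<in> borel_measurable (path_space n)"
      by (auto intro: path_space_component_measurable)
    show "{x \<in> space (path_space n). \<bar>real i - real j\<bar> \<le> d \<and> a < \<bar>x i - x j\<bar>} \<in> sets (path_space n)"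
      by measurable
  qed simp_all
  also have "{x \<in> space (path_space n). \<exists>i\<in>{..n}. \<exists>j\<in>{..n}. \<bar>real i - real j\<bar> \<le> d \<and> a < \<bar>x i - x j\<bar>}
      = osc_exceeds n d a"
    by (auto simp: osc_exceeds_def)
  finally show ?thesis .
qed

lemma max_exceeds_antimono: "b \<le> a \<Longrightarrow> max_exceeds n a \<subseteq> max_exceeds n b"
  unfolding max_exceeds_def by (auto intro: le_less_trans)

lemma osc_exceeds_mono:
  assumes "d \<le> e" "b \<le> a"
  shows "osc_exceeds n d a \<subseteq> osc_exceeds n e b"
proof
  fix x assume "x \<in> osc_exceeds n d a"
  then obtain i j where "x \<in> space (path_space n)" "i \<le> n" "j \<le> n" "\<bar>real i - real j\<bar> \<le> d" "a < \<bar>x i - x j\<bar>"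
    by (auto simp: osc_exceeds_def)
  moreover from this have "\<bar>real i - real j\<bar> \<le> e" "b < \<bar>x i - x j\<bar>" using assms by linarith+
  ultimately show "x \<in> osc_exceeds n e b" unfolding osc_exceeds_def by blast
qed

text \<open>Meant for excursions that are short compared with \<open>N\<close>: for these the window
  gives no information and the maximum alone has to be small.\<close>

lemma osc_exceeds_subset_max_exceeds: "osc_exceeds n d a \<subseteq> max_exceeds n (a / 2)"
proof
  fix x assume "x \<in> osc_exceeds n d a"
  then obtain i j where ij: "x \<in> space (path_space n)" "i \<le> n" "j \<le> n" "a < \<bar>x i - x j\<bar>"
    by (auto simp: osc_exceeds_def)
  then have "a / 2 < \<bar>x i\<bar> \<or> a / 2 < \<bar>x j\<bar>" by linarith
  then show "x \<in> max_exceeds n (a / 2)" using ij by (auto simp: max_exceeds_def)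
qed

section \<open>From the bad events to tightness\<close>

lemma rescale_in_modulus_class:
  assumes n: "n \<ge> 1" and A: "A > 0" and x: "x \<in> space (path_space n)"
    and mx: "x \<notin> max_exceeds n (A * sqrt (real n))"
    and osc: "\<And>k. x \<notin> osc_exceeds n (\<delta> k * real n) (\<eta> k * sqrt (real n))"
    and pos: "\<And>k. \<delta> k > 0" "\<And>k. \<eta> k > 0"
  shows "rescale n x \<in> modulus_class A (\<lambda>k. min (\<delta> k / 2) (\<eta> k * \<delta> k / (4 * A))) (\<lambda>k. 3 * \<eta> k)"
proof -
  have B: "\<bar>x i\<bar> \<le> A * sqrt (real n)" if "i \<le> n" for i
    using mx x that by (force simp: max_exceeds_def)
  have "\<bar>rescale n x s\<bar> \<le> A" if "s \<in> {0..1}" for s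
    using rescale_abs_le[OF n that B] n by simp
  moreover have "\<bar>rescale n x s - rescale n x t\<bar> \<le> 3 * \<eta> k"
    if s: "s \<in> {0..1}" and t: "t \<in> {0..1}" and st: "\<bar>s - t\<bar> < min (\<delta> k / 2) (\<eta> k * \<delta> k / (4 * A))" for s t k
  \<comment> \<open>If the window spans two cells, half of it leaves room for the rounding error of
    one cell. Otherwise \<open>n < 2 / \<delta> k\<close>, and the Lipschitz bound
    \<open>2 * A * n * \<bar>s - t\<bar>\<close> is at most \<open>\<eta> k\<close>; the second
    entry of the minimum is tuned to this.\<close>
  proof (cases "2 \<le> \<delta> k * real n")
    case True
    have "\<bar>x i - x j\<bar> \<le> \<eta> k * sqrt (real n)"
      if "i \<le> n" "j \<le> n" "\<bar>real i - real j\<bar> \<le> \<delta> k * real n" for i j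
      using osc[of k] x that by (force simp: osc_exceeds_def)
    moreover have "real n * \<bar>s - t\<bar> \<le> real n * (\<delta> k / 2)"
      using st by (intro mult_left_mono) auto
    then have "real n * \<bar>s - t\<bar> + 1 \<le> \<delta> k * real n"
      using True by (simp add: mult.commute)
    ultimately have "\<bar>rescale n x s - rescale n x t\<bar> \<le> 3 * (\<eta> k * sqrt (real n)) / sqrt (real n)"
      by (rule rescale_modulus[OF n s t])
    then show ?thesis using n by simp
  next
    case False
    have "\<bar>rescale n x s - rescale n x t\<bar> \<le> 2 * (A * sqrt (real n)) / sqrt (real n) * (real n * \<bar>s - t\<bar>)"
      by (rule rescale_lipschitz[OF n B s t])
    also have "\<dots> = 2 * A * (real n * \<bar>s - t\<bar>)" using n by simp
    also have "\<dots> \<le> 2 * A * ((2 / \<delta> k) * (\<eta> k * \<delta> k / (4 * A)))"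
    proof (intro mult_left_mono mult_mono)
      show "real n \<le> 2 / \<delta> k" using False pos(1)[of k] by (simp add: field_simps)
    qed (use st A pos[of k] in auto)
    also have "\<dots> = \<eta> k" using A pos(1)[of k] by (simp add: field_simps)
    finally show ?thesis using pos(2)[of k] by linarith
  qed
  ultimately show ?thesis
    using rescale_in_C01[OF n] by (simp add: modulus_class_def)
qed

lemma rescale_notin_equibounded:
  assumes n: "n \<ge> 1" and x: "x \<in> max_exceeds n (A * sqrt (real n))"
    and K: "\<forall>f\<in>K. \<forall>s\<in>{0..1}. \<bar>f s\<bar> \<le> A"
  shows "rescale n x \<notin> K"
proof
  assume xK: "rescale n x \<in> K"
  obtain i where i: "i \<le> n" "A * sqrt (real n) < \<bar>x i\<bar>"
    using x by (auto simp: max_exceeds_def)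
  have "\<bar>rescale n x (real i / real n)\<bar> \<le> A"
    using K xK i n by auto
  then show False
    using i n by (simp add: rescale_grid abs_divide divide_le_eq)
qed

lemma rescale_notin_equicontinuous:
  assumes n: "n \<ge> 1" and x: "x \<in> osc_exceeds n (\<delta> * real n) (\<eta> * sqrt (real n))"
    and K: "\<forall>f\<in>K. \<forall>s\<in>{0..1}. \<forall>t\<in>{0..1}. \<bar>s - t\<bar> \<le> \<delta> \<longrightarrow> \<bar>f s - f t\<bar> \<le> \<eta>"
  shows "rescale n x \<notin> K"
proof
  assume xK: "rescale n x \<in> K"
  obtain i j where ij: "i \<le> n" "j \<le> n" "\<bar>real i - real j\<bar> \<le> \<delta> * real n" "\<eta> * sqrt (real n) < \<bar>x i - x j\<bar>"
    using x by (auto simp: osc_exceeds_def)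
  have "\<bar>real i / real n - real j / real n\<bar> \<le> \<delta>"
    using ij(3) n by (simp add: diff_divide_distrib[symmetric] abs_divide divide_le_eq)
  then have "\<bar>rescale n x (real i / real n) - rescale n x (real j / real n)\<bar> \<le> \<eta>"
    using K xK ij n by auto
  then show False
    using ij n by (simp add: rescale_grid abs_divide divide_le_eq diff_divide_distrib[symmetric])
qed

text \<open>\<open>G\<close> will be the preimage of an arbitrary compact set and may fail to be
  measurable. Then its \<open>measure\<close> is 0, which forces \<open>1 \<le> \<epsilon>\<close>,
  and the claim is trivial.\<close>

lemma (in prob_space) prob_le_of_disjoint:
  assumes "B \<in> events" "G \<inter> B = {}" "G \<subseteq> space M" "1 - \<epsilon> \<le> prob G" "0 < \<epsilon>"
  shows "prob B \<le> \<epsilon>"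
proof (cases "G \<in> events")
  case True
  have "prob G \<le> prob (space M - B)"
    using assms True by (intro finite_measure_mono) auto
  then show ?thesis using prob_compl[OF assms(1)] assms(4) by linarith
next
  case False
  then have "prob G = 0" by (rule measure_notin_sets)
  then show ?thesis using assms(4) prob_le_1[of B] by linarith
qed

lemma tight_C01_iff:
  assumes prob: "\<And>n. n \<ge> 1 \<Longrightarrow> prob_space (M n)"
    and sets_M: "\<And>n. n \<ge> 1 \<Longrightarrow> sets (M n) = sets (path_space n)"
  shows "tight_C01 M \<longleftrightarrow>
      (\<forall>\<epsilon>>0. \<exists>A>0. \<forall>n\<ge>1. measure (M n) (max_exceeds n (A * sqrt (real n))) \<le> \<epsilon>) \<and>
      (\<forall>\<epsilon>>0. \<forall>\<eta>>0. \<exists>\<delta>>0. \<forall>n\<ge>1.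
         measure (M n) (osc_exceeds n (\<delta> * real n) (\<eta> * sqrt (real n))) \<le> \<epsilon>)"
    (is "_ \<longleftrightarrow> ?Mx \<and> ?Osc")
proof
  assume tight: "tight_C01 M"
  have bound: "measure (M n) B \<le> \<epsilon>"
    if "n \<ge> 1" "\<epsilon> > 0" "B \<in> sets (path_space n)" "\<And>x. x \<in> B \<Longrightarrow> rescale n x \<notin> K"
      "1 - \<epsilon> \<le> measure (M n) {x \<in> space (M n). rescale n x \<in> K}" for n \<epsilon> B K
  proof -
    interpret prob_space "M n" using prob that by simp
    show ?thesis
      by (rule prob_le_of_disjoint[OF _ _ _ that(5,2)]) (use that sets_M in auto)
  qed
  show "?Mx \<and> ?Osc"
  proof (intro conjI allI impI)
    fix \<epsilon> :: real assume "\<epsilon> > 0"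
    then obtain K where K: "compactin (mtopology_of C01) K"
      "\<forall>n\<ge>1. 1 - \<epsilon> \<le> measure (M n) {x \<in> space (M n). rescale n x \<in> K}"
      using tight unfolding tight_C01_def by meson
    obtain A where A: "\<forall>f\<in>K. \<forall>s\<in>{0..1}. \<bar>f s\<bar> \<le> A"
      using compactin_C01_equibounded(1)[OF K(1)] by blast
    \<comment> \<open>The criterion asks for a positive level, which the bound \<open>A\<close> need
      not be.\<close>
    have A1: "\<forall>f\<in>K. \<forall>s\<in>{0..1}. \<bar>f s\<bar> \<le> max A 1"
      using A by (auto simp: le_max_iff_disj)
    have "measure (M n) (max_exceeds n (max A 1 * sqrt (real n))) \<le> \<epsilon>" if "n \<ge> 1" for n
      using K(2) that
      by (intro bound[OF that \<open>\<epsilon> > 0\<close>, where K = K] max_exceeds_sets)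
         (auto dest: rescale_notin_equibounded[OF that _ A1])
    then show "\<exists>A>0. \<forall>n\<ge>1. measure (M n) (max_exceeds n (A * sqrt (real n))) \<le> \<epsilon>"
      by (intro exI[of _ "max A 1"]) auto
    fix \<eta> :: real assume "\<eta> > 0"
    then obtain \<delta> where \<delta>: "\<delta> > 0"
      "\<forall>f\<in>K. \<forall>s\<in>{0..1}. \<forall>t\<in>{0..1}. \<bar>s - t\<bar> \<le> \<delta> \<longrightarrow> \<bar>f s - f t\<bar> \<le> \<eta>"
      using compactin_C01_equibounded(2)[OF K(1)] by blast
    have "measure (M n) (osc_exceeds n (\<delta> * real n) (\<eta> * sqrt (real n))) \<le> \<epsilon>" if "n \<ge> 1" for n
      using K(2) that
      by (intro bound[OF that \<open>\<epsilon> > 0\<close>, where K = K] osc_exceeds_sets)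
         (auto dest: rescale_notin_equicontinuous[OF that _ \<delta>(2)])
    then show "\<exists>\<delta>>0. \<forall>n\<ge>1. measure (M n) (osc_exceeds n (\<delta> * real n) (\<eta> * sqrt (real n))) \<le> \<epsilon>"
      using \<delta>(1) by blast
  qed
next
  have space_M: "space (M n) = space (path_space n)" if "n \<ge> 1" for n
    using sets_M[OF that] by (rule sets_eq_imp_space_eq)
  assume H: "?Mx \<and> ?Osc"
  show "tight_C01 M"
    unfolding tight_C01_def
  proof (intro allI impI)
    fix \<epsilon> :: real assume \<epsilon>: "\<epsilon> > 0"
    then have "\<epsilon> / 2 > 0" by simp
    then obtain A where A: "A > 0" "\<And>n. n \<ge> 1 \<Longrightarrow> measure (M n) (max_exceeds n (A * sqrt (real n))) \<le> \<epsilon> / 2"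
      using H by blast
    \<comment> \<open>One oscillation bound for each scale \<open>\<eta> k\<close>, with errors
      \<open>e k\<close> that add up to \<open>\<epsilon> / 2\<close>; the maximum uses the other
      half.\<close>
    define \<eta> where "\<eta> k = 1 / real (Suc k)" for k
    define e where "e k = \<epsilon> / 2 * (1 / 2) ^ Suc k" for k
    have \<eta>: "\<eta> k > 0" for k by (simp add: \<eta>_def)
    have e: "e k > 0" for k using \<epsilon> by (simp add: e_def)
    have "\<exists>\<delta>>0. \<forall>n\<ge>1. measure (M n) (osc_exceeds n (\<delta> * real n) (\<eta> k * sqrt (real n))) \<le> e k" for k
      using H \<eta>[of k] e[of k] by blast
    then obtain \<delta> where \<delta>: "\<And>k. \<delta> k > 0"
      "\<And>k n. n \<ge> 1 \<Longrightarrow> measure (M n) (osc_exceeds n (\<delta> k * real n) (\<eta> k * sqrt (real n))) \<le> e k"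
      by metis
    define K where "K = modulus_class A (\<lambda>k. min (\<delta> k / 2) (\<eta> k * \<delta> k / (4 * A))) (\<lambda>k. 3 * \<eta> k)"
    have "(\<lambda>k. 3 * \<eta> k) \<longlonglongrightarrow> 3 * 0"
      unfolding \<eta>_def by (intro tendsto_mult tendsto_const LIMSEQ_Suc lim_1_over_n)
    then have "compactin (mtopology_of C01) K"
      unfolding K_def by (intro compactin_modulus_class) (simp_all add: \<delta>(1) \<eta> A(1))
    moreover have "1 - \<epsilon> \<le> measure (M n) {x \<in> space (M n). rescale n x \<in> K}" if n: "n \<ge> 1" for n
    proof -
      interpret prob_space "M n" using prob n by simp
      note [simp] = sets_M[OF n] space_M[OF n]
      let ?mx = "max_exceeds n (A * sqrt (real n))"
      let ?osc = "\<lambda>k. osc_exceeds n (\<delta> k * real n) (\<eta> k * sqrt (real n))"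
      have sums: "e sums (\<epsilon> / 2 * 1)"
        unfolding e_def by (intro sums_mult power_half_series)
      have summ: "summable (\<lambda>k. prob (?osc k))"
        by (rule summable_comparison_test[OF _ sums_summable[OF sums]]) (use \<delta>(2)[OF n] in auto)
      have "prob (?mx \<union> (\<Union>k. ?osc k)) \<le> prob ?mx + prob (\<Union>k. ?osc k)"
        by (rule measure_Un_le) auto
      also have "prob (\<Union>k. ?osc k) \<le> (\<Sum>k. prob (?osc k))"
        by (intro finite_measure_subadditive_countably summ) auto
      also have "\<dots> \<le> (\<Sum>k. e k)"
        by (intro suminf_le summ sums_summable[OF sums] \<delta> n)
      also have "\<dots> = \<epsilon> / 2" using sums_unique[OF sums] by simp
      finally have bad: "prob (?mx \<union> (\<Union>k. ?osc k)) \<le> \<epsilon>" using A(2)[OF n] by simp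
      have G: "{x \<in> space (M n). rescale n x \<in> K} \<in> events"
        unfolding K_def using rescale_vimage_modulus_class[OF n] by simp
      have "1 - prob (?mx \<union> (\<Union>k. ?osc k)) = prob (space (M n) - (?mx \<union> (\<Union>k. ?osc k)))"
        by (intro prob_compl[symmetric]) auto
      also have "\<dots> \<le> prob {x \<in> space (M n). rescale n x \<in> K}"
        using G by (intro finite_measure_mono)
          (auto simp: K_def intro!: rescale_in_modulus_class[OF n A(1) _ _ _ \<delta>(1) \<eta>])
      finally show ?thesis using bad by linarith
    qed
    ultimately show "\<exists>K. compactin (mtopology_of C01) K \<and>
        (\<forall>n\<ge>1. 1 - \<epsilon> \<le> measure (M n) {x \<in> space (M n). rescale n x \<in> K})"
      by blast
  qed
qed

lemma tight_C01_max_exceeds: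
  assumes "\<And>n. n \<ge> 1 \<Longrightarrow> prob_space (M n)" "\<And>n. n \<ge> 1 \<Longrightarrow> sets (M n) = sets (path_space n)"
    and "tight_C01 M" "\<epsilon> > 0"
  obtains A where "A > 0" "\<And>n. n \<ge> 1 \<Longrightarrow> measure (M n) (max_exceeds n (A * sqrt (real n))) \<le> \<epsilon>"
  using tight_C01_iff[OF assms(1,2), THEN iffD1, OF _ _ assms(3), THEN conjunct1, rule_format, OF _ _ assms(4)]
  by blast

lemma tight_C01_osc_exceeds:
  assumes "\<And>n. n \<ge> 1 \<Longrightarrow> prob_space (M n)" "\<And>n. n \<ge> 1 \<Longrightarrow> sets (M n) = sets (path_space n)"
    and "tight_C01 M" "\<epsilon> > 0" "\<eta> > 0"
  obtains \<delta> where "\<delta> > 0"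
    "\<And>n. n \<ge> 1 \<Longrightarrow> measure (M n) (osc_exceeds n (\<delta> * real n) (\<eta> * sqrt (real n))) \<le> \<epsilon>"
  using tight_C01_iff[OF assms(1,2), THEN iffD1, OF _ _ assms(3), THEN conjunct2, rule_format, OF _ _ assms(4,5)]
  by blast

section \<open>Epochs and concatenation of excursions\<close>

definition epoch_set :: "nat \<Rightarrow> nat set \<Rightarrow> bool" where
  "epoch_set N S \<longleftrightarrow> 0 \<in> S \<and> S \<subseteq> {..N}"

lemma epoch_set_finite: "epoch_set N S \<Longrightarrow> finite S"
  unfolding epoch_set_def by (auto intro: finite_subset)

lemma next_epoch_bounds:
  assumes "epoch_set N S" "s < N"
  shows "s < next_epoch N S s" "next_epoch N S s \<le> N"
proof -
  have fin: "finite ({u \<in> S. s < u} \<union> {N})"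
    using epoch_set_finite[OF assms(1)] by simp
  show "next_epoch N S s \<le> N"
    unfolding next_epoch_def using fin by (intro Min_le) auto
  show "s < next_epoch N S s"
    unfolding next_epoch_def using fin assms(2) by (subst Min_gr_iff) auto
qed

lemma next_epoch_le:
  assumes "epoch_set N S" "u \<in> S" "s < u"
  shows "next_epoch N S s \<le> u"
  unfolding next_epoch_def using epoch_set_finite[OF assms(1)] assms(2,3) by (intro Min_le) auto

lemma next_epoch_in:
  assumes "epoch_set N S" "u \<in> S" "s < u"
  shows "next_epoch N S s \<in> S"
proof -
  have "next_epoch N S s \<in> {u \<in> S. s < u} \<union> {N}"
    unfolding next_epoch_def using epoch_set_finite[OF assms(1)] by (intro Min_in) auto
  moreover have "u \<le> N" using assms by (auto simp: epoch_set_def)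
  moreover have "next_epoch N S s \<le> u" using assms by (rule next_epoch_le)
  ultimately show ?thesis using assms(2) by auto
qed

lemma next_epoch_last:
  assumes "\<not> (\<exists>u\<in>S. s < u)"
  shows "next_epoch N S s = N"
proof -
  have e: "{u \<in> S. s < u} = {}" using assms by blast
  show ?thesis unfolding next_epoch_def e by simp
qed

text \<open>The largest epoch up to \<open>i\<close> works: if its next epoch were at most
  \<open>i\<close>, that would be a larger one. Here an excursion owns its starting epoch; in the
  companion lemma it owns its end, as in \<open>concat_exc\<close>, which reads an epoch from the
  preceding excursion.\<close>

lemma excursion_containing_left:
  assumes "epoch_set N S" "i < N"
  obtains s where "s \<in> S" "s \<le> i" "i < next_epoch N S s"
proof -
  let ?U = "{u \<in> S. u \<le> i}"
  have fin: "finite ?U" "?U \<noteq> {}"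
    using epoch_set_finite[OF assms(1)] assms(1) by (auto simp: epoch_set_def)
  then have M: "Max ?U \<in> ?U" by (rule Max_in)
  have "i < next_epoch N S (Max ?U)"
  proof (rule ccontr)
    assume a: "\<not> i < next_epoch N S (Max ?U)"
    have sN: "Max ?U < N" using M assms(2) by auto
    have lt: "Max ?U < next_epoch N S (Max ?U)" by (rule next_epoch_bounds(1)[OF assms(1) sN])
    have "next_epoch N S (Max ?U) \<noteq> N" using a assms(2) by auto
    then have "\<exists>u\<in>S. Max ?U < u" using next_epoch_last by metis
    then have "next_epoch N S (Max ?U) \<in> S" using next_epoch_in[OF assms(1)] by blast
    then have "next_epoch N S (Max ?U) \<le> Max ?U" using a fin by (intro Max_ge) auto
    then show False using lt by simp
  qed
  then show ?thesis using that[of "Max ?U"] M by auto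
qed

lemma excursion_containing_right:
  assumes "epoch_set N S" "0 < k" "k \<le> N"
  obtains s where "s \<in> S" "s < k" "k \<le> next_epoch N S s"
proof -
  have "k - 1 < N" using assms by simp
  then obtain s where "s \<in> S" "s \<le> k - 1" "k - 1 < next_epoch N S s"
    using excursion_containing_left[OF assms(1)] by blast
  then show ?thesis using that[of s] assms(2) by auto
qed

lemma excursion_unique:
  assumes "epoch_set N S" "s \<in> S" "r \<in> S" "next_epoch N S s > r" "next_epoch N S r > s"
  shows "s = r"
  using assms next_epoch_le[of N S] by (metis leD linorder_neqE_nat)

text \<open>The half-open time intervals of the excursions are disjoint subsets of
  \<open>{..<N}\<close>.\<close>

lemma sum_excursion_lengths_le:
  assumes "epoch_set N S"
  shows "(\<Sum>s\<in>{s \<in> S. s < N}. next_epoch N S s - s) \<le> N"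
proof -
  let ?I = "{s \<in> S. s < N}"
  have fin: "finite ?I" using epoch_set_finite[OF assms] by simp
  have "(\<Sum>s\<in>?I. next_epoch N S s - s) = (\<Sum>s\<in>?I. card {s..<next_epoch N S s})" by simp
  also have "\<dots> = card (\<Union>s\<in>?I. {s..<next_epoch N S s})"
  proof (rule card_UN_disjoint[symmetric, OF fin])
    show "\<forall>s\<in>?I. \<forall>r\<in>?I. s \<noteq> r \<longrightarrow> {s..<next_epoch N S s} \<inter> {r..<next_epoch N S r} = {}"
    proof (intro ballI impI)
      fix s r assume sr: "s \<in> ?I" "r \<in> ?I" "s \<noteq> r"
      show "{s..<next_epoch N S s} \<inter> {r..<next_epoch N S r} = {}"
      proof (rule ccontr)
        assume "{s..<next_epoch N S s} \<inter> {r..<next_epoch N S r} \<noteq> {}"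
        then have "next_epoch N S s > r" "next_epoch N S r > s" by auto
        then show False using excursion_unique[OF assms] sr by blast
      qed
    qed
  qed simp
  also have "\<dots> \<le> card {..<N}"
  proof (rule card_mono)
    show "(\<Union>s\<in>?I. {s..<next_epoch N S s}) \<subseteq> {..<N}"
      using next_epoch_bounds(2)[OF assms] by fastforce
  qed simp
  finally show ?thesis by simp
qed

lemma concat_exc_eq:
  assumes "epoch_set N S" "s \<in> S" "s < k" "k \<le> next_epoch N S s" "k \<le> N"
  shows "concat_exc N S y k = y s (k - s)"
proof -
  have "Max {u \<in> S. u < k} = s"
  proof (rule Max_eqI)
    fix u assume u: "u \<in> {u \<in> S. u < k}"
    show "u \<le> s"
    proof (rule ccontr)
      assume "\<not> u \<le> s"
      then have "next_epoch N S s \<le> u" using next_epoch_le[OF assms(1)] u by simp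
      then show False using u assms(4) by simp
    qed
  qed (use epoch_set_finite[OF assms(1)] assms in auto)
  then show ?thesis using assms by (simp add: concat_exc_def)
qed

text \<open>The laws guarantee these zeros only almost surely, so pathwise lemmas take them as a
  hypothesis. The end of a final excursion is left free.\<close>

definition excursion_ends :: "nat \<Rightarrow> nat set \<Rightarrow> (nat \<Rightarrow> nat \<Rightarrow> real) \<Rightarrow> bool" where
  "excursion_ends N S y \<longleftrightarrow> (\<forall>s\<in>{s \<in> S. s < N}. y s 0 = 0 \<and>
     ((\<exists>u\<in>S. s < u) \<longrightarrow> y s (next_epoch N S s - s) = 0))"

text \<open>A positive epoch takes its value from the excursion that ends there. That excursion is
  followed by an epoch, so it is a bulk excursion and ends at zero.\<close>

lemma concat_exc_epoch:
  assumes S: "epoch_set N S" and y: "excursion_ends N S y" and s: "s \<in> S"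
  shows "concat_exc N S y s = 0"
proof (cases "s = 0")
  case True
  then show ?thesis by (simp add: concat_exc_def)
next
  case False
  have sN: "s \<le> N" using S s by (auto simp: epoch_set_def)
  obtain r where r: "r \<in> S" "r < s" "s \<le> next_epoch N S r"
    using excursion_containing_right[OF S _ sN] False by blast
  then have eq: "next_epoch N S r = s" using next_epoch_le[OF S s, of r] by simp
  have "concat_exc N S y s = y r (s - r)"
    by (rule concat_exc_eq[OF S r sN])
  also have "\<dots> = 0"
    using y r s sN unfolding excursion_ends_def eq[symmetric] by (auto simp: eq)
  finally show ?thesis .
qed

lemma concat_exc_eq':
  assumes S: "epoch_set N S" and y: "excursion_ends N S y"
    and "s \<in> S" "s < N" "s \<le> k" "k \<le> next_epoch N S s"
  shows "concat_exc N S y k = y s (k - s)"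
proof (cases "k = s")
  case True
  then show ?thesis
    using concat_exc_epoch[OF S y \<open>s \<in> S\<close>] y assms(3,4) by (simp add: excursion_ends_def)
next
  case False
  then show ?thesis
    using assms next_epoch_bounds(2)[OF S \<open>s < N\<close>] by (intro concat_exc_eq) auto
qed

lemma concat_exc_max_exceeds:
  assumes S: "epoch_set N S" and x: "concat_exc N S y \<in> max_exceeds N a" and a: "a \<ge> 0"
    and y: "\<And>s. s \<in> S \<Longrightarrow> s < N \<Longrightarrow> y s \<in> space (path_space (next_epoch N S s - s))"
  shows "\<exists>s\<in>{s \<in> S. s < N}. y s \<in> max_exceeds (next_epoch N S s - s) a"
proof -
  obtain i where i: "i \<le> N" "a < \<bar>concat_exc N S y i\<bar>"
    using x by (auto simp: max_exceeds_def)
  \<comment> \<open>The path is 0 at time 0 by definition, so a nonnegative level is exceeded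
    later.\<close>
  then have "0 < i" using a by (cases i) (auto simp: concat_exc_def)
  then obtain s where s: "s \<in> S" "s < i" "i \<le> next_epoch N S s"
    using excursion_containing_right[OF S _ i(1)] by blast
  have "concat_exc N S y i = y s (i - s)" by (rule concat_exc_eq[OF S s i(1)])
  then have "y s \<in> max_exceeds (next_epoch N S s - s) a"
    using y[of s] s i by (auto simp: max_exceeds_def intro!: exI[of _ "i - s"])
  then show ?thesis using s i by auto
qed

text \<open>Two times in different excursions are compared through the zeros that separate them, hence
  the factor 2.\<close>

lemma concat_exc_osc_exceeds:
  assumes S: "epoch_set N S" and ends: "excursion_ends N S y"
    and x: "concat_exc N S y \<in> osc_exceeds N d a" and a: "a \<ge> 0"
    and y: "\<And>s. s \<in> S \<Longrightarrow> s < N \<Longrightarrow> y s \<in> space (path_space (next_epoch N S s - s))"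
  shows "\<exists>s\<in>{s \<in> S. s < N}. y s \<in> osc_exceeds (next_epoch N S s - s) d (a / 2)"
proof -
  let ?x = "concat_exc N S y"
  have same: "?thesis"
    if "s \<in> S" "s < N" "s \<le> i" "i \<le> j" "j \<le> next_epoch N S s" "real j - real i \<le> d" "a / 2 < \<bar>?x i - ?x j\<bar>" for s i j
  proof -
    have "?x i = y s (i - s)" "?x j = y s (j - s)"
      using that by (auto intro!: concat_exc_eq'[OF S ends])
    then have "y s \<in> osc_exceeds (next_epoch N S s - s) d (a / 2)"
      using y[OF that(1,2)] that unfolding osc_exceeds_def
      by (intro CollectI conjI exI[of _ "i - s"] exI[of _ "j - s"]) (auto simp: of_nat_diff)
    then show ?thesis using that by blast
  qed
  have *: ?thesis if ij: "i < j" "j \<le> N" "real j - real i \<le> d" "a < \<bar>?x i - ?x j\<bar>" for i j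
  proof -
    obtain s where s: "s \<in> S" "s \<le> i" "i < next_epoch N S s"
      using excursion_containing_left[OF S, of i] ij by auto
    obtain r where r: "r \<in> S" "r < j" "j \<le> next_epoch N S r"
      using excursion_containing_right[OF S, of j] ij by auto
    show ?thesis
    proof (cases "j \<le> next_epoch N S s")
      case True
      then show ?thesis using same[of s i j] s ij a by linarith
    next
      case False
      have sr: "s < r"
      proof (rule ccontr)
        assume "\<not> s < r"
        then have "r = s \<or> r < s" by auto
        then show False using False r s ij next_epoch_le[OF S s(1), of r] by auto
      qed
      let ?e = "next_epoch N S s"
      have er: "?e \<le> r" by (rule next_epoch_le[OF S r(1) sr])
      have e0: "?x ?e = 0"
        by (rule concat_exc_epoch[OF S ends next_epoch_in[OF S r(1) sr]])
      have r0: "?x r = 0" by (rule concat_exc_epoch[OF S ends r(1)])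
      \<comment> \<open>Both epochs carry the value 0, so one of the two ends of the increment
        exceeds \<open>a / 2\<close>; since \<open>i < ?e \<le> r < j\<close>, each piece stays
        within the window \<open>d\<close>.\<close>
      have "a / 2 < \<bar>?x i - ?x ?e\<bar> \<or> a / 2 < \<bar>?x r - ?x j\<bar>"
        using ij(4) e0 r0 by linarith
      then show ?thesis
      proof
        assume "a / 2 < \<bar>?x i - ?x ?e\<bar>"
        then show ?thesis using s ij er r by (intro same[of s i ?e]) auto
      next
        assume "a / 2 < \<bar>?x r - ?x j\<bar>"
        then show ?thesis using s ij er r by (intro same[of r r j]) auto
      qed
    qed
  qed
  obtain i j where ij: "i \<le> N" "j \<le> N" "\<bar>real i - real j\<bar> \<le> d" "a < \<bar>?x i - ?x j\<bar>"
    using x by (auto simp: osc_exceeds_def)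
  consider "i < j" | "j < i" | "i = j" by linarith
  then show ?thesis
  proof cases
    case 1
    then show ?thesis using *[of i j] ij by auto
  next
    case 2
    then show ?thesis using *[of j i] ij by (auto simp: abs_minus_commute)
  next
    case 3
    then show ?thesis using ij a by auto
  qed
qed

text \<open>The endpoint \<open>m * t\<close> is itself an epoch, so all \<open>m\<close> excursions
  are bulk excursions of length \<open>t\<close>.\<close>

lemma regular_epochs:
  fixes m t :: nat
  assumes "t \<ge> 1"
  defines "S \<equiv> (\<lambda>k. k * t) ` {..m}"
  shows "epoch_set (m * t) S"
    and "{s \<in> S. s < m * t} = (\<lambda>k. k * t) ` {..<m}"
    and "s \<in> S \<Longrightarrow> s < m * t \<Longrightarrow> next_epoch (m * t) S s = s + t"
    and "s \<in> S \<Longrightarrow> s < m * t \<Longrightarrow> \<exists>u\<in>S. s < u"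
proof -
  show E: "epoch_set (m * t) S"
    by (auto simp: epoch_set_def S_def)
  show "{s \<in> S. s < m * t} = (\<lambda>k. k * t) ` {..<m}"
    using assms(1) by (auto simp: S_def)
  assume "s \<in> S" "s < m * t"
  then obtain k where k: "k < m" "s = k * t" by (auto simp: S_def)
  have in_S: "s + t \<in> S"
    unfolding S_def using k by (intro image_eqI[of _ _ "Suc k"]) auto
  then show "\<exists>u\<in>S. s < u" using assms(1) by (intro bexI[of _ "s + t"]) auto
  have "next_epoch (m * t) S s \<in> S"
    using in_S assms(1) by (intro next_epoch_in[OF E]) auto
  then obtain j where j: "next_epoch (m * t) S s = j * t" by (auto simp: S_def)
  have "s < j * t" using next_epoch_bounds(1)[OF E \<open>s < m * t\<close>] j by simp
  then have "Suc k * t \<le> j * t" using k by (intro mult_le_mono1) simp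
  moreover have "next_epoch (m * t) S s \<le> s + t"
    using in_S assms(1) by (intro next_epoch_le[OF E]) auto
  ultimately show "next_epoch (m * t) S s = s + t" using j k by simp
qed

section \<open>The regeneration law\<close>

locale excursion_laws =
  fixes Pbulk Pfin :: "nat \<Rightarrow> (nat \<Rightarrow> real) measure"
  assumes bulk_prob: "t \<ge> 1 \<Longrightarrow> prob_space (Pbulk t)"
    and bulk_sets: "t \<ge> 1 \<Longrightarrow> sets (Pbulk t) = sets (path_space t)"
    and bulk_ends: "t \<ge> 1 \<Longrightarrow> AE x in Pbulk t. x 0 = 0 \<and> x t = 0"
    and fin_prob: "t \<ge> 1 \<Longrightarrow> prob_space (Pfin t)"
    and fin_sets: "t \<ge> 1 \<Longrightarrow> sets (Pfin t) = sets (path_space t)"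
    and fin_start: "t \<ge> 1 \<Longrightarrow> AE x in Pfin t. x 0 = 0"
begin

text \<open>After the last epoch \<open>next_epoch\<close> returns \<open>N\<close>, so the length
  of a final excursion has the same expression as that of a bulk one.\<close>

lemma exc_law_eq:
  assumes "epoch_set N S" "s < N"
  shows "exc_law Pbulk Pfin N S s =
    (if \<exists>u\<in>S. s < u then Pbulk (next_epoch N S s - s) else Pfin (next_epoch N S s - s))"
proof (cases "\<exists>u\<in>S. s < u")
  case True
  then show ?thesis by (simp add: exc_law_def)
next
  case False
  show ?thesis unfolding exc_law_def next_epoch_last[OF False] by simp
qed

lemma exc_law_prob:
  assumes "epoch_set N S" "s < N"
  shows "prob_space (exc_law Pbulk Pfin N S s)"
  unfolding exc_law_eq[OF assms] using next_epoch_bounds[OF assms] by (simp add: bulk_prob fin_prob)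

lemma exc_law_sets:
  assumes "epoch_set N S" "s < N"
  shows "sets (exc_law Pbulk Pfin N S s) = sets (path_space (next_epoch N S s - s))"
  unfolding exc_law_eq[OF assms] using next_epoch_bounds[OF assms] by (simp add: bulk_sets fin_sets)

lemma exc_law_space:
  assumes "epoch_set N S" "s < N"
  shows "space (exc_law Pbulk Pfin N S s) = space (path_space (next_epoch N S s - s))"
  using exc_law_sets[OF assms] by (rule sets_eq_imp_space_eq)

abbreviation exc_product :: "nat \<Rightarrow> nat set \<Rightarrow> (nat \<Rightarrow> nat \<Rightarrow> real) measure" where
  "exc_product N S \<equiv> PiM {s \<in> S. s < N} (exc_law Pbulk Pfin N S)"

lemma exc_product_prob:
  assumes "epoch_set N S"
  shows "prob_space (exc_product N S)"
  using exc_law_prob[OF assms] by (intro prob_space_PiM) auto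

lemma AE_exc_component:
  assumes S: "epoch_set N S" and s: "s \<in> S" "s < N" and P: "AE x in exc_law Pbulk Pfin N S s. P x"
  shows "AE y in exc_product N S. P (y s)"
proof -
  have eq: "distr (exc_product N S) (exc_law Pbulk Pfin N S s) (\<lambda>y. y s) = exc_law Pbulk Pfin N S s"
    using s exc_law_prob[OF S] by (intro distr_PiM_component) auto
  show ?thesis
  proof (rule AE_distrD[where f = "\<lambda>y. y s" and P = P])
    show "(\<lambda>y. y s) \<in> exc_product N S \<rightarrow>\<^sub>M exc_law Pbulk Pfin N S s"
      using s by (intro measurable_component_singleton) simp
    show "AE x in distr (exc_product N S) (exc_law Pbulk Pfin N S s) (\<lambda>y. y s). P x"
      unfolding eq by (rule P)
  qed
qed

lemma AE_excursion_ends: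
  assumes S: "epoch_set N S"
  shows "AE y in exc_product N S. excursion_ends N S y"
proof -
  have "AE y in exc_product N S. y s 0 = 0 \<and> ((\<exists>u\<in>S. s < u) \<longrightarrow> y s (next_epoch N S s - s) = 0)"
    if "s \<in> {s \<in> S. s < N}" for s
  proof -
    have s: "s \<in> S" "s < N" using that by auto
    have l: "next_epoch N S s - s \<ge> 1" using next_epoch_bounds[OF S s(2)] by simp
    have "AE x in exc_law Pbulk Pfin N S s. x 0 = 0 \<and> ((\<exists>u\<in>S. s < u) \<longrightarrow> x (next_epoch N S s - s) = 0)"
      unfolding exc_law_eq[OF S s(2)] using bulk_ends[OF l] fin_start[OF l] by auto
    then show ?thesis by (rule AE_exc_component[OF S s])
  qed
  then show ?thesis
    unfolding excursion_ends_def using epoch_set_finite[OF S] by (intro AE_finite_allI) auto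
qed

lemma exc_component_sets:
  assumes S: "epoch_set N S" and s: "s \<in> S" "s < N" and E: "E \<in> sets (path_space (next_epoch N S s - s))"
  shows "{y \<in> space (exc_product N S). y s \<in> E} \<in> sets (exc_product N S)"
proof -
  have "(\<lambda>y. y s) \<in> exc_product N S \<rightarrow>\<^sub>M exc_law Pbulk Pfin N S s"
    using s by (intro measurable_component_singleton) auto
  moreover have "E \<in> sets (exc_law Pbulk Pfin N S s)" using E exc_law_sets[OF S s(2)] by simp
  ultimately show ?thesis by measurable
qed

lemma exc_product_component:
  assumes S: "epoch_set N S" and y: "y \<in> space (exc_product N S)" and s: "s \<in> S" "s < N"
  shows "y s \<in> space (path_space (next_epoch N S s - s))"
proof -
  have "y s \<in> space (exc_law Pbulk Pfin N S s)" using y s by (auto simp: space_PiM PiE_iff)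
  then show ?thesis by (simp only: exc_law_space[OF S s(2)])
qed

lemma concat_exc_measurable:
  assumes S: "epoch_set N S"
  shows "concat_exc N S \<in> exc_product N S \<rightarrow>\<^sub>M path_space N"
proof -
  have "(\<lambda>y k. concat_exc N S y k) \<in> exc_product N S \<rightarrow>\<^sub>M PiM {..N} (\<lambda>_. borel)"
  proof (rule measurable_PiM_single')
    fix k assume "k \<in> {..N}"
    then have k: "k \<le> N" by simp
    show "(\<lambda>y. concat_exc N S y k) \<in> exc_product N S \<rightarrow>\<^sub>M borel"
    proof (cases "k = 0")
      case True
      then show ?thesis by (simp add: concat_exc_def)
    next
      case False
      then obtain s where s: "s \<in> S" "s < k" "k \<le> next_epoch N S s"
        using excursion_containing_right[OF S _ k] by blast
      have sN: "s < N" using s k by simp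
      have "(\<lambda>x. x (k - s)) \<in> borel_measurable (path_space (next_epoch N S s - s))"
        using s by (intro path_space_component_measurable) simp
      then have "(\<lambda>x. x (k - s)) \<in> borel_measurable (exc_law Pbulk Pfin N S s)"
        using measurable_cong_sets[OF exc_law_sets[OF S sN] refl] by blast
      moreover have "(\<lambda>y. y s) \<in> exc_product N S \<rightarrow>\<^sub>M exc_law Pbulk Pfin N S s"
        using s sN by (intro measurable_component_singleton) auto
      ultimately have "(\<lambda>y. y s (k - s)) \<in> borel_measurable (exc_product N S)"
        by (rule measurable_compose[rotated])
      then show ?thesis using concat_exc_eq[OF S s k] by simp
    qed
  qed (auto simp: concat_exc_def PiE_iff extensional_def)
  then show ?thesis by (simp add: path_space_def)
qed

section \<open>The law of the path given its epochs\<close>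

lemma sets_regen_given_epochs [simp]:
  "sets (regen_given_epochs Pbulk Pfin N S) = sets (path_space N)"
  by (simp add: regen_given_epochs_def)

lemma prob_space_regen_given_epochs:
  assumes "epoch_set N S"
  shows "prob_space (regen_given_epochs Pbulk Pfin N S)"
  unfolding regen_given_epochs_def
  by (rule prob_space.prob_space_distr[OF exc_product_prob[OF assms] concat_exc_measurable[OF assms]])

lemma measure_regen_given_epochs:
  assumes "epoch_set N S" "F \<in> sets (path_space N)"
  shows "measure (regen_given_epochs Pbulk Pfin N S) F =
    measure (exc_product N S) {y \<in> space (exc_product N S). concat_exc N S y \<in> F}"
  unfolding regen_given_epochs_def
  by (subst measure_distr[OF concat_exc_measurable[OF assms(1)] assms(2)])
     (simp add: vimage_def Int_def conj_commute)

lemma measure_exc_component: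
  assumes S: "epoch_set N S" and s: "s \<in> S" "s < N" and E: "E \<in> sets (path_space (next_epoch N S s - s))"
  shows "measure (exc_product N S) {y \<in> space (exc_product N S). y s \<in> E} = measure (exc_law Pbulk Pfin N S s) E"
proof -
  have "measure (exc_law Pbulk Pfin N S s) E
     = measure (distr (exc_product N S) (exc_law Pbulk Pfin N S s) (\<lambda>y. y s)) E"
    using s exc_law_prob[OF S] by (subst distr_PiM_component) auto
  also have "\<dots> = measure (exc_product N S) ((\<lambda>y. y s) -` E \<inter> space (exc_product N S))"
    using s E exc_law_sets[OF S s(2)] by (intro measure_distr) auto
  also have "(\<lambda>y. y s) -` E \<inter> space (exc_product N S) = {y \<in> space (exc_product N S). y s \<in> E}"
    by auto
  finally show ?thesis by simp
qed

text \<open>The inclusion of events is required only where the excursions have their zeros, which is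
  almost everywhere.\<close>

lemma regen_given_epochs_union_bound:
  assumes S: "epoch_set N S" and F: "F \<in> sets (path_space N)"
    and E: "\<And>s. E s \<in> sets (path_space (next_epoch N S s - s))"
    and sub: "\<And>y. y \<in> space (exc_product N S) \<Longrightarrow> excursion_ends N S y \<Longrightarrow> concat_exc N S y \<in> F \<Longrightarrow>
      \<exists>s\<in>{s \<in> S. s < N}. y s \<in> E s"
  shows "measure (regen_given_epochs Pbulk Pfin N S) F
    \<le> (\<Sum>s\<in>{s \<in> S. s < N}. measure (exc_law Pbulk Pfin N S s) (E s))"
proof -
  let ?Q = "exc_product N S" and ?I = "{s \<in> S. s < N}"
  interpret prob_space ?Q by (rule exc_product_prob[OF S])
  have fin: "finite ?I" using epoch_set_finite[OF S] by simp
  have ev: "{y \<in> space ?Q. y s \<in> E s} \<in> sets ?Q" if "s \<in> ?I" for s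
    using that by (intro exc_component_sets[OF S _ _ E]) simp_all
  have "prob {y \<in> space ?Q. concat_exc N S y \<in> F} \<le> prob (\<Union>s\<in>?I. {y \<in> space ?Q. y s \<in> E s})"
  proof (rule finite_measure_mono_AE)
    show "AE y in ?Q. y \<in> {y \<in> space ?Q. concat_exc N S y \<in> F} \<longrightarrow> y \<in> (\<Union>s\<in>?I. {y \<in> space ?Q. y s \<in> E s})"
      using AE_excursion_ends[OF S] by eventually_elim (use sub in blast)
    show "(\<Union>s\<in>?I. {y \<in> space ?Q. y s \<in> E s}) \<in> events"
      using ev fin by (intro sets.finite_UN) auto
  qed
  also have "\<dots> \<le> (\<Sum>s\<in>?I. prob {y \<in> space ?Q. y s \<in> E s})"
    using ev fin by (intro finite_measure_subadditive_finite) auto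
  also have "\<dots> = (\<Sum>s\<in>?I. measure (exc_law Pbulk Pfin N S s) (E s))"
    by (intro sum.cong refl measure_exc_component[OF S _ _ E]) simp_all
  finally show ?thesis by (simp add: measure_regen_given_epochs[OF S F])
qed

text \<open>The counterpart of the union bound: that no excursion lies in its \<open>E s\<close> is
  a box event, whose product probability factorizes; off this box the path lies in
  \<open>F\<close>.\<close>

lemma regen_given_epochs_independence_bound:
  assumes S: "epoch_set N S" and F: "F \<in> sets (path_space N)"
    and E: "\<And>s. E s \<in> sets (path_space (next_epoch N S s - s))"
    and sub: "\<And>y s. y \<in> space (exc_product N S) \<Longrightarrow> excursion_ends N S y \<Longrightarrow>
      s \<in> S \<Longrightarrow> s < N \<Longrightarrow> y s \<in> E s \<Longrightarrow> concat_exc N S y \<in> F"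
  shows "1 - (\<Prod>s\<in>{s \<in> S. s < N}. 1 - measure (exc_law Pbulk Pfin N S s) (E s))
    \<le> measure (regen_given_epochs Pbulk Pfin N S) F"
proof -
  let ?Q = "exc_product N S" and ?I = "{s \<in> S. s < N}" and ?L = "exc_law Pbulk Pfin N S"
  interpret prob_space ?Q by (rule exc_product_prob[OF S])
  have fin: "finite ?I" using epoch_set_finite[OF S] by simp
  have EL: "E s \<in> sets (?L s)" if "s \<in> ?I" for s
    using that E exc_law_sets[OF S] by simp
  have Fm: "{y \<in> space ?Q. concat_exc N S y \<in> F} \<in> events"
    using concat_exc_measurable[OF S] F by measurable
  let ?A = "\<lambda>s. space (?L s) - E s"
  have box: "prod_emb ?I ?L ?I (Pi\<^sub>E ?I ?A) = Pi\<^sub>E ?I ?A"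
    by (rule prod_emb_id) auto
  have "emeasure ?Q (prod_emb ?I ?L ?I (Pi\<^sub>E ?I ?A)) = (\<Prod>s\<in>?I. emeasure (?L s) (?A s))"
    using fin EL by (intro emeasure_PiM_emb) (auto intro: exc_law_prob[OF S])
  then have "emeasure ?Q (Pi\<^sub>E ?I ?A) = (\<Prod>s\<in>?I. emeasure (?L s) (?A s))"
    unfolding box .
  also have "\<dots> = (\<Prod>s\<in>?I. ennreal (1 - measure (?L s) (E s)))"
  proof (rule prod.cong[OF refl])
    fix s assume s: "s \<in> ?I"
    interpret L: prob_space "?L s" using s exc_law_prob[OF S] by simp
    show "emeasure (?L s) (?A s) = ennreal (1 - measure (?L s) (E s))"
      using L.prob_compl[OF EL[OF s]] by (simp add: L.emeasure_eq_measure)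
  qed
  also have "\<dots> = ennreal (\<Prod>s\<in>?I. 1 - measure (?L s) (E s))"
  proof (rule prod_ennreal)
    fix s assume s: "s \<in> ?I"
    interpret L: prob_space "?L s" using s exc_law_prob[OF S] by simp
    show "0 \<le> 1 - measure (?L s) (E s)" by simp
  qed
  finally have "ennreal (prob (Pi\<^sub>E ?I ?A)) = ennreal (\<Prod>s\<in>?I. 1 - measure (?L s) (E s))"
    by (simp add: emeasure_eq_measure)
  moreover have "0 \<le> (\<Prod>s\<in>?I. 1 - measure (?L s) (E s))"
    using exc_law_prob[OF S] by (intro prod_nonneg) (simp add: prob_space.prob_le_1)
  ultimately have P: "prob (Pi\<^sub>E ?I ?A) = (\<Prod>s\<in>?I. 1 - measure (?L s) (E s))"
    by simp
  have bm: "Pi\<^sub>E ?I ?A \<in> events"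
    using fin EL by (intro sets_PiM_I_finite) auto
  have "1 - prob (Pi\<^sub>E ?I ?A) = prob (space ?Q - Pi\<^sub>E ?I ?A)"
    using prob_compl[OF bm] by simp
  also have "\<dots> \<le> prob {y \<in> space ?Q. concat_exc N S y \<in> F}"
  proof (rule finite_measure_mono_AE[OF _ Fm])
    show "AE y in ?Q. y \<in> space ?Q - Pi\<^sub>E ?I ?A \<longrightarrow> y \<in> {y \<in> space ?Q. concat_exc N S y \<in> F}"
      using AE_excursion_ends[OF S]
    proof eventually_elim
      case (elim y)
      show ?case
      proof
        assume y: "y \<in> space ?Q - Pi\<^sub>E ?I ?A"
        then have "\<exists>s\<in>?I. y s \<in> E s" by (auto simp: space_PiM PiE_iff)
        then show "y \<in> {y \<in> space ?Q. concat_exc N S y \<in> F}" using sub[OF _ elim] y by auto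
      qed
    qed
  qed
  finally show ?thesis by (simp add: P measure_regen_given_epochs[OF S F])
qed

section \<open>Averaging over the epochs\<close>

text \<open>On infinite sets \<^const>\<open>next_epoch\<close> is a junk \<open>Min\<close>, so the kernel \<^const>\<open>regen_given_epochs\<close> need
  not be measurable into the subprobability measures; it is corrected off the support of \<open>p\<close>.\<close>

lemma regen_law_P_eq:
  assumes "regen_law N p"
  shows "regen_law_P p Pbulk Pfin N = measure_pmf p \<bind>
    (\<lambda>S. regen_given_epochs Pbulk Pfin N (if epoch_set N S then S else {0}))"
    and "(\<lambda>S. regen_given_epochs Pbulk Pfin N (if epoch_set N S then S else {0}))
      \<in> measure_pmf p \<rightarrow>\<^sub>M subprob_algebra (path_space N)"
proof -
  let ?f = "regen_given_epochs Pbulk Pfin N"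
    and ?g = "\<lambda>S. regen_given_epochs Pbulk Pfin N (if epoch_set N S then S else {0})"
  have ep: "epoch_set N S" if "S \<in> set_pmf p" for S
    using assms that by (auto simp: regen_law_def epoch_set_def)
  \<comment> \<open>\<open>distr\<close> is defined through the masses of preimages, and every set
    is measurable for a pmf. Kernels that agree on the support thus have equal \<open>distr\<close>,
    and \<open>bind\<close> sees the kernel only through it and through the common sigma algebra of
    its values.\<close>
  have "emeasure (measure_pmf p) (?f -` X) = emeasure (measure_pmf p) (?g -` X)" for X
    by (rule emeasure_eq_AE) (auto simp: AE_measure_pmf_iff ep)
  then have "distr (measure_pmf p) (subprob_algebra (path_space N)) ?f
      = distr (measure_pmf p) (subprob_algebra (path_space N)) ?g"
    unfolding distr_def by simp
  then show "regen_law_P p Pbulk Pfin N = measure_pmf p \<bind> ?g"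
    unfolding regen_law_P_def bind_def
    by (simp add: subprob_algebra_cong[OF sets_regen_given_epochs])
  have "subprob_space (?g S)" for S
    by (intro prob_space_imp_subprob_space prob_space_regen_given_epochs) (simp add: epoch_set_def)
  then show "?g \<in> measure_pmf p \<rightarrow>\<^sub>M subprob_algebra (path_space N)"
    by (simp add: space_subprob_algebra)
qed

lemma sets_regen_law_P [simp]:
  "sets (regen_law_P p Pbulk Pfin N) = sets (path_space N)"
  unfolding regen_law_P_def by (rule sets_bind) auto

lemma prob_space_regen_law_P:
  assumes "regen_law N p"
  shows "prob_space (regen_law_P p Pbulk Pfin N)"
  unfolding regen_law_P_eq(1)[OF assms]
proof (rule measure_pmf.prob_space_bind[OF _ regen_law_P_eq(2)[OF assms]])
  show "AE S in measure_pmf p. prob_space (regen_given_epochs Pbulk Pfin N (if epoch_set N S then S else {0}))"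
    by (intro AE_I2 prob_space_regen_given_epochs) (simp add: epoch_set_def)
qed

lemma measure_regen_law_P_le:
  assumes p: "regen_law N p" and F: "F \<in> sets (path_space N)"
    and bound: "\<And>S. epoch_set N S \<Longrightarrow> measure (regen_given_epochs Pbulk Pfin N S) F \<le> \<epsilon>"
  shows "measure (regen_law_P p Pbulk Pfin N) F \<le> \<epsilon>"
proof -
  let ?g = "\<lambda>S. regen_given_epochs Pbulk Pfin N (if epoch_set N S then S else {0})"
  have e: "epoch_set N (if epoch_set N S then S else {0})" for S by (simp add: epoch_set_def)
  have "measure (regen_law_P p Pbulk Pfin N) F = (\<integral>S. measure (?g S) F \<partial>measure_pmf p)"
    unfolding regen_law_P_eq(1)[OF p] by (rule measure_pmf.measure_bind[OF regen_law_P_eq(2)[OF p] F])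
  also have "\<dots> \<le> \<epsilon>"
  proof (rule measure_pmf.integral_le_const)
    show "integrable (measure_pmf p) (\<lambda>S. measure (?g S) F)"
      using prob_space.prob_le_1[OF prob_space_regen_given_epochs[OF e]]
      by (intro measure_pmf.integrable_const_bound[where B = 1]) auto
  qed (use bound[OF e] in auto)
  finally show ?thesis .
qed

lemma regen_law_P_return:
  assumes "epoch_set N S"
  shows "regen_law_P (return_pmf S) Pbulk Pfin N = regen_given_epochs Pbulk Pfin N S"
proof -
  have p: "regen_law N (return_pmf S)" using assms by (simp add: regen_law_def epoch_set_def)
  have "regen_law_P (return_pmf S) Pbulk Pfin N = return (count_space UNIV) S \<bind>
    (\<lambda>S. regen_given_epochs Pbulk Pfin N (if epoch_set N S then S else {0}))"
    unfolding regen_law_P_eq(1)[OF p] by (simp add: return_pmf.rep_eq)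
  also have "\<dots> = regen_given_epochs Pbulk Pfin N S"
    using regen_law_P_eq(2)[OF p] assms by (subst bind_return[where N = "path_space N"]) auto
  finally show ?thesis .
qed

subsection \<open>Sufficiency\<close>

lemma bulk_max_eq:
  assumes "t \<ge> 1"
  shows "{x \<in> space (Pbulk t). (MAX i\<in>{..t}. \<bar>x i\<bar>) / sqrt (real t) > a} = max_exceeds t (a * sqrt (real t))"
proof -
  have "a < (MAX i\<in>{..t}. \<bar>x i\<bar>) / sqrt (real t) \<longleftrightarrow> (\<exists>i\<le>t. a * sqrt (real t) < \<bar>x i\<bar>)" for x :: "nat \<Rightarrow> real"
  proof -
    have "a < (MAX i\<in>{..t}. \<bar>x i\<bar>) / sqrt (real t) \<longleftrightarrow> a * sqrt (real t) < (MAX i\<in>{..t}. \<bar>x i\<bar>)"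
      using assms by (simp add: less_divide_eq)
    also have "\<dots> \<longleftrightarrow> (\<exists>i\<le>t. a * sqrt (real t) < \<bar>x i\<bar>)"
      by (subst Max_gr_iff) auto
    finally show ?thesis .
  qed
  then show ?thesis
    unfolding max_exceeds_def sets_eq_imp_space_eq[OF bulk_sets[OF assms]] by simp
qed

text \<open>The little-o condition in epsilon form, with the supremum turned into a bound for each
  \<open>t\<close>.\<close>

definition bulk_tail_vanishes :: bool where
  "bulk_tail_vanishes \<longleftrightarrow> (\<forall>\<kappa>>0. \<exists>a\<^sub>0>0. \<forall>a\<ge>a\<^sub>0. \<forall>t\<ge>1.
     measure (Pbulk t) (max_exceeds t (a * sqrt (real t))) \<le> \<kappa> / a\<^sup>2)"

lemma bulk_tail_smallo_iff:
  "(\<lambda>a::real. SUP t\<in>{1::nat..}. measure (Pbulk t)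
      {x \<in> space (Pbulk t). (MAX i\<in>{..t}. \<bar>x i\<bar>) / sqrt (real t) > a}) \<in> o[at_top](\<lambda>a. 1 / a\<^sup>2)
   \<longleftrightarrow> bulk_tail_vanishes"
   (is "?g \<in> _ \<longleftrightarrow> _")
proof -
  let ?m = "\<lambda>a t. measure (Pbulk t) (max_exceeds t (a * sqrt (real t)))"
  have g: "?g = (\<lambda>a. SUP t\<in>{1..}. ?m a t)"
    by (intro ext SUP_cong refl) (simp add: bulk_max_eq)
  \<comment> \<open>A real supremum can be compared termwise only for bounded families; here
    probabilities are bounded by 1.\<close>
  have bdd: "bdd_above (?m a ` {1..})" for a
    using bulk_prob by (intro bdd_aboveI2[where M = 1]) (auto intro: prob_space.prob_le_1)
  have le: "(SUP t\<in>{1..}. ?m a t) \<le> c \<longleftrightarrow> (\<forall>t\<ge>1. ?m a t \<le> c)" for a c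
    using bdd[of a] by (subst cSUP_le_iff) auto
  have nn: "0 \<le> (SUP t\<in>{1..}. ?m a t)" for a
    using bdd[of a] by (intro cSUP_upper2[where x = 1]) auto
  have key: "norm (SUP t\<in>{1..}. ?m a t) \<le> c * norm (1 / a\<^sup>2) \<longleftrightarrow> (\<forall>t\<ge>1. ?m a t \<le> c / a\<^sup>2)" for a c
    using nn[of a] le[of a "c / a\<^sup>2"] by simp
  show ?thesis
    unfolding g bulk_tail_vanishes_def
  proof
    assume o: "(\<lambda>a. SUP t\<in>{1..}. ?m a t) \<in> o[at_top](\<lambda>a. 1 / a\<^sup>2)"
    show "\<forall>\<kappa>>0. \<exists>a\<^sub>0>0. \<forall>a\<ge>a\<^sub>0. \<forall>t\<ge>1. ?m a t \<le> \<kappa> / a\<^sup>2"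
    proof (intro allI impI)
      fix \<kappa> :: real assume "\<kappa> > 0"
      then have "eventually (\<lambda>a. norm (SUP t\<in>{1..}. ?m a t) \<le> \<kappa> * norm (1 / a\<^sup>2)) at_top"
        using landau_o.smallD[OF o] by blast
      then obtain a0 where a0: "\<forall>a\<ge>a0. \<forall>t\<ge>1. ?m a t \<le> \<kappa> / a\<^sup>2"
        unfolding key eventually_at_top_linorder by blast
      show "\<exists>a\<^sub>0>0. \<forall>a\<ge>a\<^sub>0. \<forall>t\<ge>1. ?m a t \<le> \<kappa> / a\<^sup>2"
        using a0 by (intro exI[of _ "max a0 1"]) auto
    qed
  next
    assume H: "\<forall>\<kappa>>0. \<exists>a\<^sub>0>0. \<forall>a\<ge>a\<^sub>0. \<forall>t\<ge>1. ?m a t \<le> \<kappa> / a\<^sup>2"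
    show "(\<lambda>a. SUP t\<in>{1..}. ?m a t) \<in> o[at_top](\<lambda>a. 1 / a\<^sup>2)"
    proof (rule landau_o.smallI)
      fix c :: real assume "c > 0"
      then show "eventually (\<lambda>a. norm (SUP t\<in>{1..}. ?m a t) \<le> c * norm (1 / a\<^sup>2)) at_top"
        unfolding key eventually_at_top_linorder using H by blast
    qed
  qed
qed

lemma measure_bulk_mono:
  assumes "t \<ge> 1" "A \<subseteq> B" "B \<in> sets (path_space t)"
  shows "measure (Pbulk t) A \<le> measure (Pbulk t) B"
proof -
  interpret prob_space "Pbulk t" using bulk_prob assms by simp
  show ?thesis using assms bulk_sets[OF assms(1)] by (intro finite_measure_mono) auto
qed

lemma measure_fin_mono:
  assumes "t \<ge> 1" "A \<subseteq> B" "B \<in> sets (path_space t)"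
  shows "measure (Pfin t) A \<le> measure (Pfin t) B"
proof -
  interpret prob_space "Pfin t" using fin_prob assms by simp
  show ?thesis using assms fin_sets[OF assms(1)] by (intro finite_measure_mono) auto
qed

text \<open>The bounds for bulk excursions are proportional to their length, so they can be summed over all
  excursions of a path. Short excursions are controlled by the tail condition, long ones by tightness.\<close>

lemma bulk_max_bound:
  assumes le: "\<forall>a\<ge>a\<^sub>0. \<forall>t\<ge>1. measure (Pbulk t) (max_exceeds t (a * sqrt (real t))) \<le> \<kappa> / a\<^sup>2"
    and l: "1 \<le> l" "l \<le> N" "a\<^sub>0 * sqrt (real l) \<le> a * sqrt (real N)"
  shows "measure (Pbulk l) (max_exceeds l (a * sqrt (real N))) \<le> \<kappa> / a\<^sup>2 * (real l / real N)"
proof -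
  \<comment> \<open>The level \<open>a * sqrt N\<close> in units of \<open>sqrt l\<close>; its
    square turns the quadratic decay into the factor \<open>l / N\<close>.\<close>
  define b where "b = a * sqrt (real N) / sqrt (real l)"
  have l0: "sqrt (real l) > 0" using l by simp
  have "a\<^sub>0 \<le> b" unfolding b_def using l l0 by (simp add: le_divide_eq)
  then have "measure (Pbulk l) (max_exceeds l (b * sqrt (real l))) \<le> \<kappa> / b\<^sup>2" using le l by blast
  moreover have "b * sqrt (real l) = a * sqrt (real N)" using l0 by (simp add: b_def)
  moreover have "b\<^sup>2 = a\<^sup>2 * (real N / real l)"
    using l by (simp add: b_def power_mult_distrib power_divide)
  ultimately show ?thesis by simp
qed

lemma bulk_max_bound_uniform:
  assumes tail: bulk_tail_vanishes and "\<epsilon> > 0"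
  shows "\<exists>A>0. \<forall>N l. 1 \<le> l \<and> l \<le> N \<longrightarrow>
    measure (Pbulk l) (max_exceeds l (A * sqrt (real N))) \<le> \<epsilon> * (real l / real N)"
proof -
  obtain a0 where a0: "a0 > 0" "\<forall>a\<ge>a0. \<forall>t\<ge>1. measure (Pbulk t) (max_exceeds t (a * sqrt (real t))) \<le> \<epsilon> / a\<^sup>2"
    using tail \<open>\<epsilon> > 0\<close> unfolding bulk_tail_vanishes_def by blast
  \<comment> \<open>Since \<open>l \<le> N\<close>, \<open>A \<ge> a0\<close> already puts every
    excursion in the range of the tail condition, whatever its length; \<open>A \<ge> 1\<close>
    absorbs the factor \<open>1 / A\<^sup>2\<close>.\<close>
  define A where "A = max a0 1"
  have A: "A \<ge> a0" "A \<ge> 1" by (auto simp: A_def)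
  have "measure (Pbulk l) (max_exceeds l (A * sqrt (real N))) \<le> \<epsilon> * (real l / real N)"
    if l: "1 \<le> l" "l \<le> N" for N l
  proof -
    have "a0 * sqrt (real l) \<le> A * sqrt (real N)"
      using A l a0 by (intro mult_mono) auto
    then have "measure (Pbulk l) (max_exceeds l (A * sqrt (real N))) \<le> \<epsilon> / A\<^sup>2 * (real l / real N)"
      by (rule bulk_max_bound[OF a0(2) l])
    also have "\<dots> \<le> \<epsilon> * (real l / real N)"
      using \<open>\<epsilon> > 0\<close> A by (intro mult_right_mono) (auto simp: divide_le_eq)
    finally show ?thesis .
  qed
  then show ?thesis using A by (intro exI[of _ A]) auto
qed

lemma bulk_osc_bound:
  assumes tight: "tight_C01 Pbulk" and tail: bulk_tail_vanishes and \<epsilon>: "\<epsilon> > 0" and \<eta>: "\<eta> > 0"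
  shows "\<exists>\<delta>>0. \<forall>N l. 1 \<le> l \<and> l \<le> N \<longrightarrow>
    measure (Pbulk l) (osc_exceeds l (\<delta> * real N) (\<eta> * sqrt (real N))) \<le> \<epsilon> * (real l / real N)"
proof -
  \<comment> \<open>Chosen so that the tail bound at level \<open>\<eta> / 2\<close> has constant
    exactly \<epsilon>.\<close>
  define \<kappa> where "\<kappa> = \<epsilon> * (\<eta> / 2)\<^sup>2"
  have "\<kappa> > 0" using \<epsilon> \<eta> by (simp add: \<kappa>_def)
  then obtain a0 where a0: "a0 > 0" "\<forall>a\<ge>a0. \<forall>t\<ge>1. measure (Pbulk t) (max_exceeds t (a * sqrt (real t))) \<le> \<kappa> / a\<^sup>2"
    using tail unfolding bulk_tail_vanishes_def by blast
  \<comment> \<open>The threshold between short and long: \<open>l \<le> \<gamma> * N\<close> means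
    precisely that the level \<open>\<eta> / 2 * sqrt N\<close> is at least
    \<open>a0 * sqrt l\<close>, where the tail condition applies.\<close>
  define \<gamma> where "\<gamma> = (\<eta> / (2 * a0))\<^sup>2"
  have \<gamma>: "\<gamma> > 0" using \<eta> a0 by (simp add: \<gamma>_def)
  \<comment> \<open>For long excursions \<open>\<gamma> < l / N\<close>, so the error
    \<open>\<epsilon> * \<gamma>\<close> from tightness is below the required
    \<open>\<epsilon> * l / N\<close>.\<close>
  have "\<epsilon> * \<gamma> > 0" using \<epsilon> \<gamma> by simp
  then obtain \<delta> where \<delta>: "\<delta> > 0"
    "\<And>l. l \<ge> 1 \<Longrightarrow> measure (Pbulk l) (osc_exceeds l (\<delta> * real l) (\<eta> * sqrt (real l))) \<le> \<epsilon> * \<gamma>"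
    using tight_C01_osc_exceeds[OF bulk_prob bulk_sets tight _ \<eta>] by metis
  have "measure (Pbulk l) (osc_exceeds l (\<delta> * \<gamma> * real N) (\<eta> * sqrt (real N))) \<le> \<epsilon> * (real l / real N)"
    if l: "1 \<le> l" "l \<le> N" for N l
  proof (cases "real l \<le> \<gamma> * real N")
    case True
    then have "sqrt (real l) \<le> sqrt \<gamma> * sqrt (real N)"
      by (simp add: real_sqrt_mult[symmetric])
    also have "sqrt \<gamma> = \<eta> / (2 * a0)" using \<eta> a0 by (simp add: \<gamma>_def)
    finally have "a0 * sqrt (real l) \<le> \<eta> / 2 * sqrt (real N)"
      using a0 by (simp add: field_simps)
    then have "measure (Pbulk l) (max_exceeds l (\<eta> / 2 * sqrt (real N))) \<le> \<kappa> / (\<eta> / 2)\<^sup>2 * (real l / real N)"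
      by (rule bulk_max_bound[OF a0(2) l])
    also have "\<kappa> / (\<eta> / 2)\<^sup>2 = \<epsilon>" using \<eta> by (simp add: \<kappa>_def)
    finally have "measure (Pbulk l) (max_exceeds l (\<eta> * sqrt (real N) / 2)) \<le> \<epsilon> * (real l / real N)"
      by simp
    moreover have "measure (Pbulk l) (osc_exceeds l (\<delta> * \<gamma> * real N) (\<eta> * sqrt (real N)))
        \<le> measure (Pbulk l) (max_exceeds l (\<eta> * sqrt (real N) / 2))"
      by (intro measure_bulk_mono l osc_exceeds_subset_max_exceeds max_exceeds_sets)
    ultimately show ?thesis by linarith
  next
    case False
    have "\<delta> * (\<gamma> * real N) \<le> \<delta> * real l" using False \<delta> by (intro mult_left_mono) auto
    moreover have "\<eta> * sqrt (real l) \<le> \<eta> * sqrt (real N)" using \<eta> l by simp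
    ultimately have "measure (Pbulk l) (osc_exceeds l (\<delta> * \<gamma> * real N) (\<eta> * sqrt (real N)))
        \<le> measure (Pbulk l) (osc_exceeds l (\<delta> * real l) (\<eta> * sqrt (real l)))"
      by (intro measure_bulk_mono l osc_exceeds_mono osc_exceeds_sets) (simp_all add: mult.assoc)
    also have "\<dots> \<le> \<epsilon> * \<gamma>" by (rule \<delta>(2)[OF l(1)])
    also have "\<dots> \<le> \<epsilon> * (real l / real N)"
      using False l \<epsilon> by (intro mult_left_mono) (auto simp: le_divide_eq)
    finally show ?thesis .
  qed
  then show ?thesis using \<delta>(1) \<gamma> by (intro exI[of _ "\<delta> * \<gamma>"]) auto
qed

text \<open>The same split into short and long excursions, but the bound carries no length factor,
  so tightness of the maximum replaces the tail condition for short ones.\<close>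

lemma fin_osc_bound:
  assumes tight: "tight_C01 Pfin" and \<epsilon>: "\<epsilon> > 0" and \<eta>: "\<eta> > 0"
  shows "\<exists>\<delta>>0. \<forall>N l. 1 \<le> l \<and> l \<le> N \<longrightarrow>
    measure (Pfin l) (osc_exceeds l (\<delta> * real N) (\<eta> * sqrt (real N))) \<le> \<epsilon>"
proof -
  obtain A where A: "A > 0" "\<And>l. l \<ge> 1 \<Longrightarrow> measure (Pfin l) (max_exceeds l (A * sqrt (real l))) \<le> \<epsilon>"
    using tight_C01_max_exceeds[OF fin_prob fin_sets tight \<epsilon>] by metis
  obtain \<delta> where \<delta>: "\<delta> > 0"
    "\<And>l. l \<ge> 1 \<Longrightarrow> measure (Pfin l) (osc_exceeds l (\<delta> * real l) (\<eta> * sqrt (real l))) \<le> \<epsilon>"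
    using tight_C01_osc_exceeds[OF fin_prob fin_sets tight \<epsilon> \<eta>] by metis
  define \<gamma> where "\<gamma> = (\<eta> / (2 * A))\<^sup>2"
  have \<gamma>: "\<gamma> > 0" using \<eta> A by (simp add: \<gamma>_def)
  have "measure (Pfin l) (osc_exceeds l (\<delta> * \<gamma> * real N) (\<eta> * sqrt (real N))) \<le> \<epsilon>"
    if l: "1 \<le> l" "l \<le> N" for N l
  proof (cases "real l \<le> \<gamma> * real N")
    case True
    then have "sqrt (real l) \<le> sqrt \<gamma> * sqrt (real N)"
      by (simp add: real_sqrt_mult[symmetric])
    also have "sqrt \<gamma> = \<eta> / (2 * A)" using \<eta> A by (simp add: \<gamma>_def)
    finally have "A * sqrt (real l) \<le> \<eta> * sqrt (real N) / 2"
      using A by (simp add: field_simps)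
    then have "osc_exceeds l (\<delta> * \<gamma> * real N) (\<eta> * sqrt (real N)) \<subseteq> max_exceeds l (A * sqrt (real l))"
      using osc_exceeds_subset_max_exceeds max_exceeds_antimono by blast
    then have "measure (Pfin l) (osc_exceeds l (\<delta> * \<gamma> * real N) (\<eta> * sqrt (real N)))
        \<le> measure (Pfin l) (max_exceeds l (A * sqrt (real l)))"
      by (intro measure_fin_mono l max_exceeds_sets)
    then show ?thesis using A(2)[OF l(1)] by linarith
  next
    case False
    have "\<delta> * (\<gamma> * real N) \<le> \<delta> * real l" using False \<delta> by (intro mult_left_mono) auto
    moreover have "\<eta> * sqrt (real l) \<le> \<eta> * sqrt (real N)" using \<eta> l by simp
    ultimately have "measure (Pfin l) (osc_exceeds l (\<delta> * \<gamma> * real N) (\<eta> * sqrt (real N)))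
        \<le> measure (Pfin l) (osc_exceeds l (\<delta> * real l) (\<eta> * sqrt (real l)))"
      by (intro measure_fin_mono l osc_exceeds_mono osc_exceeds_sets) (simp_all add: mult.assoc)
    also have "\<dots> \<le> \<epsilon>" by (rule \<delta>(2)[OF l(1)])
    finally show ?thesis .
  qed
  then show ?thesis using \<delta>(1) \<gamma> by (intro exI[of _ "\<delta> * \<gamma>"]) auto
qed

text \<open>The bulk bounds sum to at most \<open>c\<close> because the lengths sum to at most
  \<open>N\<close>; a final excursion adds one more \<open>c\<close>.\<close>

lemma sum_excursions_le:
  assumes S: "epoch_set N S" and N: "N \<ge> 1" and c: "c \<ge> 0"
    and bulk: "\<And>s l. 1 \<le> l \<Longrightarrow> l \<le> N \<Longrightarrow> l = next_epoch N S s - s \<Longrightarrow> measure (Pbulk l) (E s) \<le> c * (real l / real N)"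
    and fin: "\<And>s l. 1 \<le> l \<Longrightarrow> l \<le> N \<Longrightarrow> l = next_epoch N S s - s \<Longrightarrow> measure (Pfin l) (E s) \<le> c"
  shows "(\<Sum>s\<in>{s \<in> S. s < N}. measure (exc_law Pbulk Pfin N S s) (E s)) \<le> 2 * c"
proof -
  let ?I = "{s \<in> S. s < N}"
  let ?l = "\<lambda>s. next_epoch N S s - s"
  have fS: "finite S" by (rule epoch_set_finite[OF S])
  \<comment> \<open>Only the largest epoch can start a final excursion, so charging the extra
    \<open>c\<close> there treats both kinds in a single sum.\<close>
  have each: "measure (exc_law Pbulk Pfin N S s) (E s) \<le> c * (real (?l s) / real N) + (if s = Max S then c else 0)"
    if s: "s \<in> ?I" for s
  proof -
    have sN: "s < N" using s by simp
    have l: "1 \<le> ?l s" "?l s \<le> N" using next_epoch_bounds[OF S sN] by auto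
    show ?thesis
    proof (cases "\<exists>u\<in>S. s < u")
      case True
      then have "measure (exc_law Pbulk Pfin N S s) (E s) \<le> c * (real (?l s) / real N)"
        using bulk[OF l refl] exc_law_eq[OF S sN] by simp
      moreover have "0 \<le> (if s = Max S then c else 0)" using c by simp
      ultimately show ?thesis by linarith
    next
      case False
      then have "measure (exc_law Pbulk Pfin N S s) (E s) \<le> c"
        using fin[OF l refl] exc_law_eq[OF S sN] by simp
      moreover have "Max S = s" using False s fS by (intro Max_eqI) (auto simp: not_less)
      moreover have "0 \<le> c * (real (?l s) / real N)" using c by simp
      ultimately show ?thesis by simp
    qed
  qed
  have "(\<Sum>s\<in>?I. measure (exc_law Pbulk Pfin N S s) (E s))
      \<le> (\<Sum>s\<in>?I. c * (real (?l s) / real N) + (if s = Max S then c else 0))"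
    by (intro sum_mono each)
  also have "\<dots> = c / real N * real (\<Sum>s\<in>?I. ?l s) + (\<Sum>s\<in>?I. if s = Max S then c else 0)"
    by (simp add: sum.distrib sum_distrib_left)
  also have "c / real N * real (\<Sum>s\<in>?I. ?l s) \<le> c / real N * real N"
    using sum_excursion_lengths_le[OF S] c by (intro mult_left_mono) (auto simp del: of_nat_sum)
  also have "(\<Sum>s\<in>?I. if s = Max S then c else 0) \<le> c"
    using fS c by (subst sum.delta) auto
  finally show ?thesis using N by simp
qed

text \<open>The estimates hold given any epochs, uniformly, and hence survive averaging over every
  \<open>p N\<close>.\<close>

lemma regen_tight:
  assumes tb: "tight_C01 Pbulk" and tf: "tight_C01 Pfin" and tail: bulk_tail_vanishes
    and p: "\<And>N. regen_law N (p N)"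
  shows "tight_C01 (\<lambda>N. regen_law_P (p N) Pbulk Pfin N)"
proof (subst tight_C01_iff[OF prob_space_regen_law_P[OF p] sets_regen_law_P], intro conjI allI impI)
  fix \<epsilon> :: real assume \<epsilon>: "\<epsilon> > 0"
  then have e: "\<epsilon> / 2 > 0" by simp
  obtain A where A: "A > 0" "\<And>N l. 1 \<le> l \<Longrightarrow> l \<le> N \<Longrightarrow>
      measure (Pbulk l) (max_exceeds l (A * sqrt (real N))) \<le> \<epsilon> / 2 * (real l / real N)"
    using bulk_max_bound_uniform[OF tail e] by blast
  obtain A' where A': "A' > 0" "\<And>l. 1 \<le> l \<Longrightarrow> measure (Pfin l) (max_exceeds l (A' * sqrt (real l))) \<le> \<epsilon> / 2"
    using tight_C01_max_exceeds[OF fin_prob fin_sets tf e] by metis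
  define B where "B = max A A'"
  have "measure (regen_given_epochs Pbulk Pfin N S) (max_exceeds N (B * sqrt (real N))) \<le> \<epsilon>"
    if N: "N \<ge> 1" and S: "epoch_set N S" for N S
  proof -
    let ?E = "\<lambda>s. max_exceeds (next_epoch N S s - s) (B * sqrt (real N))"
    have "measure (regen_given_epochs Pbulk Pfin N S) (max_exceeds N (B * sqrt (real N)))
      \<le> (\<Sum>s\<in>{s \<in> S. s < N}. measure (exc_law Pbulk Pfin N S s) (?E s))"
    proof (rule regen_given_epochs_union_bound[OF S max_exceeds_sets max_exceeds_sets])
      fix y assume y: "y \<in> space (exc_product N S)" "concat_exc N S y \<in> max_exceeds N (B * sqrt (real N))"
      show "\<exists>s\<in>{s \<in> S. s < N}. y s \<in> ?E s"
        using A(1) by (intro concat_exc_max_exceeds[OF S y(2)] exc_product_component[OF S y(1)]) (auto simp: B_def)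
    qed
    also have "\<dots> \<le> 2 * (\<epsilon> / 2)"
    proof (rule sum_excursions_le[OF S N])
      fix s l assume l: "1 \<le> l" "l \<le> N" and leq: "l = next_epoch N S s - s"
      have "measure (Pbulk l) (max_exceeds l (B * sqrt (real N))) \<le> measure (Pbulk l) (max_exceeds l (A * sqrt (real N)))"
        by (intro measure_bulk_mono l max_exceeds_antimono max_exceeds_sets mult_right_mono) (auto simp: B_def)
      then show "measure (Pbulk l) (?E s) \<le> \<epsilon> / 2 * (real l / real N)"
        using A(2)[OF l] leq by simp
      have "A' * sqrt (real l) \<le> B * sqrt (real N)"
        using A'(1) l by (intro mult_mono) (auto simp: B_def)
      then have "measure (Pfin l) (max_exceeds l (B * sqrt (real N))) \<le> measure (Pfin l) (max_exceeds l (A' * sqrt (real l)))"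
        by (intro measure_fin_mono l max_exceeds_antimono max_exceeds_sets)
      then show "measure (Pfin l) (?E s) \<le> \<epsilon> / 2"
        using A'(2)[OF l(1)] leq by simp
    qed (use \<epsilon> in simp)
    finally show ?thesis by simp
  qed
  then show "\<exists>A>0. \<forall>n\<ge>1. measure (regen_law_P (p n) Pbulk Pfin n) (max_exceeds n (A * sqrt (real n))) \<le> \<epsilon>"
    using A(1) by (intro exI[of _ B] conjI allI impI measure_regen_law_P_le[OF p max_exceeds_sets])
      (auto simp: B_def)
next
  fix \<epsilon> \<eta> :: real assume "\<epsilon> > 0" "\<eta> > 0"
  \<comment> \<open>Half of \<epsilon> since \<open>sum_excursions_le\<close> doubles the error,
    half of \<eta> since concatenation can double an oscillation.\<close>
  then have e: "\<epsilon> / 2 > 0" "\<eta> / 2 > 0" by auto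
  obtain \<delta> where \<delta>: "\<delta> > 0" "\<And>N l. 1 \<le> l \<Longrightarrow> l \<le> N \<Longrightarrow>
      measure (Pbulk l) (osc_exceeds l (\<delta> * real N) (\<eta> / 2 * sqrt (real N))) \<le> \<epsilon> / 2 * (real l / real N)"
    using bulk_osc_bound[OF tb tail e] by blast
  obtain \<delta>' where \<delta>': "\<delta>' > 0" "\<And>N l. 1 \<le> l \<Longrightarrow> l \<le> N \<Longrightarrow>
      measure (Pfin l) (osc_exceeds l (\<delta>' * real N) (\<eta> / 2 * sqrt (real N))) \<le> \<epsilon> / 2"
    using fin_osc_bound[OF tf e] by blast
  define d where "d = min \<delta> \<delta>'"
  have "measure (regen_given_epochs Pbulk Pfin N S) (osc_exceeds N (d * real N) (\<eta> * sqrt (real N))) \<le> \<epsilon>"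
    if N: "N \<ge> 1" and S: "epoch_set N S" for N S
  proof -
    let ?E = "\<lambda>s. osc_exceeds (next_epoch N S s - s) (d * real N) (\<eta> / 2 * sqrt (real N))"
    have "measure (regen_given_epochs Pbulk Pfin N S) (osc_exceeds N (d * real N) (\<eta> * sqrt (real N)))
      \<le> (\<Sum>s\<in>{s \<in> S. s < N}. measure (exc_law Pbulk Pfin N S s) (?E s))"
    proof (rule regen_given_epochs_union_bound[OF S osc_exceeds_sets osc_exceeds_sets])
      fix y assume y: "y \<in> space (exc_product N S)" "excursion_ends N S y"
        "concat_exc N S y \<in> osc_exceeds N (d * real N) (\<eta> * sqrt (real N))"
      have "\<exists>s\<in>{s \<in> S. s < N}. y s \<in> osc_exceeds (next_epoch N S s - s) (d * real N) (\<eta> * sqrt (real N) / 2)"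
        using \<open>\<eta> > 0\<close> by (intro concat_exc_osc_exceeds[OF S y(2,3)] exc_product_component[OF S y(1)]) auto
      then show "\<exists>s\<in>{s \<in> S. s < N}. y s \<in> ?E s" by simp
    qed
    also have "\<dots> \<le> 2 * (\<epsilon> / 2)"
    proof (rule sum_excursions_le[OF S N])
      fix s l assume l: "1 \<le> l" "l \<le> N" and leq: "l = next_epoch N S s - s"
      have "measure (Pbulk l) (osc_exceeds l (d * real N) (\<eta> / 2 * sqrt (real N)))
          \<le> measure (Pbulk l) (osc_exceeds l (\<delta> * real N) (\<eta> / 2 * sqrt (real N)))"
        by (intro measure_bulk_mono l osc_exceeds_mono osc_exceeds_sets mult_right_mono) (auto simp: d_def)
      then show "measure (Pbulk l) (?E s) \<le> \<epsilon> / 2 * (real l / real N)"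
        unfolding leq[symmetric] using \<delta>(2)[OF l] by linarith
      have "measure (Pfin l) (osc_exceeds l (d * real N) (\<eta> / 2 * sqrt (real N)))
          \<le> measure (Pfin l) (osc_exceeds l (\<delta>' * real N) (\<eta> / 2 * sqrt (real N)))"
        by (intro measure_fin_mono l osc_exceeds_mono osc_exceeds_sets mult_right_mono) (auto simp: d_def)
      then show "measure (Pfin l) (?E s) \<le> \<epsilon> / 2"
        unfolding leq[symmetric] using \<delta>'(2)[OF l] by linarith
    qed (use \<open>\<epsilon> > 0\<close> in simp)
    finally show ?thesis by simp
  qed
  then show "\<exists>\<delta>>0. \<forall>n\<ge>1. measure (regen_law_P (p n) Pbulk Pfin n)
      (osc_exceeds n (\<delta> * real n) (\<eta> * sqrt (real n))) \<le> \<epsilon>"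
    using \<delta>(1) \<delta>'(1) by (intro exI[of _ d] conjI allI impI measure_regen_law_P_le[OF p osc_exceeds_sets])
      (auto simp: d_def)
qed

subsection \<open>Necessity\<close>

text \<open>A lone excursion is the whole path, and the independence bound then has a single factor.
  The inequality suffices, as only bounds on bad events are transferred to the excursion
  law.\<close>

lemma measure_single_excursion_le:
  assumes S: "epoch_set N S" and N: "N \<ge> 1" and single: "{s \<in> S. s < N} = {0}"
    and F: "F \<in> sets (path_space N)"
  shows "measure (exc_law Pbulk Pfin N S 0) F \<le> measure (regen_given_epochs Pbulk Pfin N S) F"
proof -
  \<comment> \<open>An epoch after 0 can only be \<open>N\<close>, and without one
    \<open>next_epoch\<close> defaults to \<open>N\<close>.\<close>
  have n0: "next_epoch N S 0 = N"
  proof (cases "\<exists>u\<in>S. 0 < u")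
    case True
    then have "next_epoch N S 0 \<in> S" "0 < next_epoch N S 0" "next_epoch N S 0 \<le> N"
      using next_epoch_in[OF S] next_epoch_bounds[OF S, of 0] N by auto
    then show ?thesis using single by (metis (mono_tags, lifting) CollectI le_neq_implies_less neq0_conv singletonD)
  qed (rule next_epoch_last)
  let ?E = "\<lambda>s. if s = 0 then F else {}"
  have "1 - (\<Prod>s\<in>{s \<in> S. s < N}. 1 - measure (exc_law Pbulk Pfin N S s) (?E s))
      \<le> measure (regen_given_epochs Pbulk Pfin N S) F"
  proof (rule regen_given_epochs_independence_bound[OF S F])
    fix s show "?E s \<in> sets (path_space (next_epoch N S s - s))"
      using F n0 by simp
  next
    fix y s assume y: "y \<in> space (exc_product N S)" "excursion_ends N S y" and "s \<in> S" "s < N" "y s \<in> ?E s"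
    then have yF: "y 0 \<in> F" by (auto split: if_splits)
    have "concat_exc N S y = y 0"
    proof (rule extensionalityI)
      show "concat_exc N S y \<in> extensional {..N}" by (simp add: concat_exc_def extensional_def)
      show "y 0 \<in> extensional {..N}"
        using yF sets.sets_into_space[OF F] by (auto simp: path_space_def space_PiM PiE_iff)
      fix k assume "k \<in> {..N}"
      then show "concat_exc N S y k = y 0 k"
        using concat_exc_eq'[OF S y(2), of 0 k] S N n0 by (simp add: epoch_set_def)
    qed
    then show "concat_exc N S y \<in> F" using yF by simp
  qed
  then show ?thesis unfolding single by simp
qed

lemma tight_of_single_excursion:
  assumes tight: "tight_C01 (\<lambda>N. regen_law_P (return_pmf (S N)) Pbulk Pfin N)"
    and S: "\<And>N. epoch_set N (S N)" and single: "\<And>N. N \<ge> 1 \<Longrightarrow> {s \<in> S N. s < N} = {0}"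
    and L: "\<And>N. N \<ge> 1 \<Longrightarrow> exc_law Pbulk Pfin N (S N) 0 = L N"
    and L_prob: "\<And>N. N \<ge> 1 \<Longrightarrow> prob_space (L N)"
    and L_sets: "\<And>N. N \<ge> 1 \<Longrightarrow> sets (L N) = sets (path_space N)"
  shows "tight_C01 L"
proof -
  have p: "regen_law N (return_pmf (S N))" for N
    using S[of N] by (simp add: regen_law_def epoch_set_def)
  note tight' = prob_space_regen_law_P[OF p] sets_regen_law_P tight
  have le: "measure (L N) F \<le> measure (regen_law_P (return_pmf (S N)) Pbulk Pfin N) F"
    if "N \<ge> 1" "F \<in> sets (path_space N)" for N F
    using measure_single_excursion_le[OF S that(1) single[OF that(1)] that(2)]
    by (simp add: regen_law_P_return[OF S] L[OF that(1)])
  show ?thesis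
  proof (rule iffD2[OF tight_C01_iff], erule L_prob, erule L_sets, intro conjI allI impI)
    fix \<epsilon> :: real assume \<epsilon>: "\<epsilon> > 0"
    obtain A where "A > 0" "\<And>n. n \<ge> 1 \<Longrightarrow>
        measure (regen_law_P (return_pmf (S n)) Pbulk Pfin n) (max_exceeds n (A * sqrt (real n))) \<le> \<epsilon>"
      using tight_C01_max_exceeds[OF tight' \<epsilon>] by metis
    then show "\<exists>A>0. \<forall>n\<ge>1. measure (L n) (max_exceeds n (A * sqrt (real n))) \<le> \<epsilon>"
      by (intro exI[of _ A] conjI allI impI) (auto intro: order_trans[OF le[OF _ max_exceeds_sets]])
    fix \<eta> :: real assume \<eta>: "\<eta> > 0"
    obtain \<delta> where "\<delta> > 0" "\<And>n. n \<ge> 1 \<Longrightarrow>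
        measure (regen_law_P (return_pmf (S n)) Pbulk Pfin n) (osc_exceeds n (\<delta> * real n) (\<eta> * sqrt (real n))) \<le> \<epsilon>"
      using tight_C01_osc_exceeds[OF tight' \<epsilon> \<eta>] by metis
    then show "\<exists>\<delta>>0. \<forall>n\<ge>1. measure (L n) (osc_exceeds n (\<delta> * real n) (\<eta> * sqrt (real n))) \<le> \<epsilon>"
      by (intro exI[of _ \<delta>] conjI allI impI) (auto intro: order_trans[OF le[OF _ osc_exceeds_sets]])
  qed
qed

text \<open>Tightness for every choice of regeneration laws is uniform in the epochs: otherwise choose, for
  each \<open>N\<close>, epochs that violate the oscillation bound at the smallest possible scale.\<close>

lemma osc_bound_uniform_in_epochs:
  assumes all: "\<And>p. (\<And>N. regen_law N (p N)) \<Longrightarrow> tight_C01 (\<lambda>N. regen_law_P (p N) Pbulk Pfin N)"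
    and \<epsilon>: "\<epsilon> > 0" and \<eta>: "\<eta> > 0"
  shows "\<exists>\<delta>>0. \<forall>N S. N \<ge> 1 \<and> epoch_set N S \<longrightarrow>
    measure (regen_given_epochs Pbulk Pfin N S) (osc_exceeds N (\<delta> * real N) (\<eta> * sqrt (real N))) \<le> \<epsilon>"
proof -
  \<comment> \<open>The window is a natural number, so that a least violating one exists; it does
    not depend on \<delta>.\<close>
  define bad where "bad N d S \<longleftrightarrow> epoch_set N S \<and>
      \<epsilon> < measure (regen_given_epochs Pbulk Pfin N S) (osc_exceeds N (real d) (\<eta> * sqrt (real N)))" for N d S
  define D where "D N = (LEAST d. \<exists>S. bad N d S)" for N
  define S where "S N = (if \<exists>d S. bad N d S then SOME S. bad N (D N) S else {0})" for N
  have badS: "bad N (D N) (S N)" if "\<exists>d S. bad N d S" for N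
  proof -
    have "\<exists>S. bad N (D N) S" unfolding D_def using that by (rule LeastI_ex)
    then have "bad N (D N) (SOME S. bad N (D N) S)" by (rule someI_ex)
    then show ?thesis using that by (simp add: S_def)
  qed
  have S: "epoch_set N (S N)" for N
  proof (cases "\<exists>d S. bad N d S")
    case True
    then show ?thesis using badS[of N] by (simp add: bad_def)
  qed (simp add: S_def epoch_set_def)
  have p: "regen_law N (return_pmf (S N))" for N
    using S[of N] by (simp add: regen_law_def epoch_set_def)
  have tight: "tight_C01 (\<lambda>N. regen_law_P (return_pmf (S N)) Pbulk Pfin N)"
    by (rule all[OF p])
  obtain \<delta> where \<delta>: "\<delta> > 0" "\<And>N. N \<ge> 1 \<Longrightarrow>
      measure (regen_law_P (return_pmf (S N)) Pbulk Pfin N) (osc_exceeds N (\<delta> * real N) (\<eta> * sqrt (real N))) \<le> \<epsilon>"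
    using tight_C01_osc_exceeds[OF prob_space_regen_law_P[OF p] sets_regen_law_P tight \<epsilon> \<eta>] by metis
  have "measure (regen_given_epochs Pbulk Pfin N T) (osc_exceeds N (\<delta> * real N) (\<eta> * sqrt (real N))) \<le> \<epsilon>"
    if N: "N \<ge> 1" and T: "epoch_set N T" for N T
  proof (rule ccontr)
    assume a: "\<not> ?thesis"
    define d where "d = nat \<lfloor>\<delta> * real N\<rfloor>"
    have d: "real d \<le> \<delta> * real N" using \<delta>(1) by (simp add: d_def)
    \<comment> \<open>Distances between grid times are integers, so rounding the window down loses
      nothing.\<close>
    have "osc_exceeds N (\<delta> * real N) (\<eta> * sqrt (real N)) \<subseteq> osc_exceeds N (real d) (\<eta> * sqrt (real N))"
    proof
      fix x assume "x \<in> osc_exceeds N (\<delta> * real N) (\<eta> * sqrt (real N))"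
      then obtain i j where ij: "x \<in> space (path_space N)" "i \<le> N" "j \<le> N" "\<bar>real i - real j\<bar> \<le> \<delta> * real N"
          "\<eta> * sqrt (real N) < \<bar>x i - x j\<bar>"
        by (auto simp: osc_exceeds_def)
      have "real_of_int \<bar>int i - int j\<bar> \<le> \<delta> * real N" using ij(4) by simp
      then have "\<bar>int i - int j\<bar> \<le> \<lfloor>\<delta> * real N\<rfloor>" by (simp add: le_floor_iff)
      then have "\<bar>int i - int j\<bar> \<le> int d" using \<delta>(1) by (simp add: d_def)
      then have "\<bar>real i - real j\<bar> \<le> real d" by linarith
      then show "x \<in> osc_exceeds N (real d) (\<eta> * sqrt (real N))"
        using ij unfolding osc_exceeds_def by blast
    qed
    then have "measure (regen_given_epochs Pbulk Pfin N T) (osc_exceeds N (\<delta> * real N) (\<eta> * sqrt (real N)))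
        \<le> measure (regen_given_epochs Pbulk Pfin N T) (osc_exceeds N (real d) (\<eta> * sqrt (real N)))"
      using prob_space_regen_given_epochs[OF T]
      by (intro finite_measure.finite_measure_mono prob_space.finite_measure) auto
    then have "bad N d T" using a T by (simp add: bad_def)
    \<comment> \<open>By minimality the chosen epochs already fail at a window no larger than
      \<open>d\<close>, hence also at \<open>\<delta> * N\<close>, against tightness for this very
      choice.\<close>
    then have "D N \<le> d" and ex: "\<exists>d S. bad N d S"
      unfolding D_def by (auto intro: Least_le)
    then have "real (D N) \<le> \<delta> * real N" using d by linarith
    then have "measure (regen_given_epochs Pbulk Pfin N (S N)) (osc_exceeds N (real (D N)) (\<eta> * sqrt (real N)))
        \<le> measure (regen_given_epochs Pbulk Pfin N (S N)) (osc_exceeds N (\<delta> * real N) (\<eta> * sqrt (real N)))"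
      using prob_space_regen_given_epochs[OF S]
      by (intro finite_measure.finite_measure_mono prob_space.finite_measure osc_exceeds_mono) auto
    then show False
      using badS[OF ex] \<delta>(2)[OF N] by (simp add: bad_def regen_law_P_return[OF S])
  qed
  then show ?thesis using \<delta>(1) by blast
qed

text \<open>An excursion starts at zero and lasts \<open>t\<close> steps, so exceeding
  \<open>a\<close> is an oscillation within a window \<open>t\<close>; the chance that none of
  \<open>m\<close> independent excursions does so is a power.\<close>

lemma regular_epochs_osc:
  assumes t: "t \<ge> 1" and a: "a \<ge> 0"
  shows "1 - (1 - measure (Pbulk t) (max_exceeds t a)) ^ m
    \<le> measure (regen_given_epochs Pbulk Pfin (m * t) ((\<lambda>k. k * t) ` {..m})) (osc_exceeds (m * t) (real t) a)"
proof -
  let ?S = "(\<lambda>k. k * t) ` {..m}" and ?N = "m * t"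
  note S = regular_epochs(1)[OF t, of m] and I = regular_epochs(2)[OF t, of m]
    and nxt = regular_epochs(3)[OF t, of _ m] and ex = regular_epochs(4)[OF t, of _ m]
  \<comment> \<open>The independence bound wants \<open>E s\<close> measurable for every
    \<open>s\<close>, also where \<open>next_epoch\<close> is not \<open>s + t\<close>; there the
    event is empty.\<close>
  let ?E = "\<lambda>s. if s \<in> ?S \<and> s < ?N then max_exceeds t a else {}"
  have law: "exc_law Pbulk Pfin ?N ?S s = Pbulk t" if "s \<in> ?S" "s < ?N" for s
    using exc_law_eq[OF S that(2)] nxt[OF that] ex[OF that] by simp
  have "1 - (\<Prod>s\<in>{s \<in> ?S. s < ?N}. 1 - measure (exc_law Pbulk Pfin ?N ?S s) (?E s))
      \<le> measure (regen_given_epochs Pbulk Pfin ?N ?S) (osc_exceeds ?N (real t) a)"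
  proof (rule regen_given_epochs_independence_bound[OF S osc_exceeds_sets])
    fix s
    show "?E s \<in> sets (path_space (next_epoch ?N ?S s - s))"
      using nxt[of s] by (simp add: max_exceeds_sets)
  next
    fix y s assume y: "y \<in> space (exc_product ?N ?S)" "excursion_ends ?N ?S y"
      and s: "s \<in> ?S" "s < ?N" and "y s \<in> ?E s"
    then obtain i where i: "i \<le> t" "a < \<bar>y s i\<bar>"
      by (auto simp: max_exceeds_def)
    have n: "next_epoch ?N ?S s = s + t" by (rule nxt[OF s])
    have "s + t \<le> ?N" using next_epoch_bounds(2)[OF S s(2)] n by simp
    moreover have "concat_exc ?N ?S y (s + i) = y s i"
      using concat_exc_eq'[OF S y(2) s, of "s + i"] i n by simp
    moreover have "concat_exc ?N ?S y s = 0"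
      by (rule concat_exc_epoch[OF S y(2) s(1)])
    moreover have "concat_exc ?N ?S y \<in> space (path_space ?N)"
      using concat_exc_measurable[OF S] y(1) by (rule measurable_space)
    ultimately show "concat_exc ?N ?S y \<in> osc_exceeds ?N (real t) a"
      using i s unfolding osc_exceeds_def
      by (intro CollectI conjI exI[of _ "s + i"] exI[of _ s]) auto
  qed
  also have "(\<Prod>s\<in>{s \<in> ?S. s < ?N}. 1 - measure (exc_law Pbulk Pfin ?N ?S s) (?E s))
      = (\<Prod>s\<in>{s \<in> ?S. s < ?N}. 1 - measure (Pbulk t) (max_exceeds t a))"
    by (intro prod.cong refl) (simp add: law)
  also have "\<dots> = (1 - measure (Pbulk t) (max_exceeds t a)) ^ m"
  proof -
    have "inj_on (\<lambda>k. k * t) {..<m}" using t by (auto simp: inj_on_def)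
    then have "card {s \<in> ?S. s < ?N} = m" unfolding I by (simp add: card_image)
    then show ?thesis by simp
  qed
  finally show ?thesis .
qed

lemma bulk_tail_necessary:
  assumes all: "\<And>p. (\<And>N. regen_law N (p N)) \<Longrightarrow> tight_C01 (\<lambda>N. regen_law_P (p N) Pbulk Pfin N)"
  shows bulk_tail_vanishes
  unfolding bulk_tail_vanishes_def
proof (intro allI impI)
  fix \<kappa> :: real assume \<kappa>: "\<kappa> > 0"
  \<comment> \<open>Inverts the bound \<open>1 - exp (- q * m)\<close>: staying below \<epsilon>
    forces \<open>q * m \<le> \<kappa> / 2\<close>.\<close>
  define \<epsilon> where "\<epsilon> = 1 - exp (- (\<kappa> / 2))"
  have "\<epsilon> > 0" using \<kappa> by (simp add: \<epsilon>_def)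
  then obtain \<delta> where \<delta>: "\<delta> > 0" "\<And>N S. N \<ge> 1 \<Longrightarrow> epoch_set N S \<Longrightarrow>
      measure (regen_given_epochs Pbulk Pfin N S) (osc_exceeds N (\<delta> * real N) (1 * sqrt (real N))) \<le> \<epsilon>"
    using osc_bound_uniform_in_epochs[OF all, of \<epsilon> 1] by auto
  \<comment> \<open>From \<open>a \<ge> 2\<close> follows
    \<open>a\<^sup>2 - 1 \<ge> a\<^sup>2 / 2\<close>, so rounding costs at most a factor 2; together
    with \<open>a \<ge> 1 + 1 / \<delta>\<close> it gives \<open>m \<ge> 1 / \<delta>\<close>, so a
    window \<open>t\<close> is at most the fraction \<delta> of the path.\<close>
  define a\<^sub>0 where "a\<^sub>0 = max 2 (1 + 1 / \<delta>)"
  have "measure (Pbulk t) (max_exceeds t (a * sqrt (real t))) \<le> \<kappa> / a\<^sup>2"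
    if a: "a \<ge> a\<^sub>0" and t: "t \<ge> 1" for a t
  proof -
    interpret prob_space "Pbulk t" by (rule bulk_prob[OF t])
    define q where "q = prob (max_exceeds t (a * sqrt (real t)))"
    have a2: "a \<ge> 2" "a \<ge> 1 + 1 / \<delta>" using a by (auto simp: a\<^sub>0_def)
    then have aa: "2 * a \<le> a\<^sup>2" by (simp add: power2_eq_square)
    define m where "m = nat \<lfloor>a\<^sup>2\<rfloor>"
    have "real m = of_int \<lfloor>a\<^sup>2\<rfloor>" by (simp add: m_def)
    then have m: "real m \<le> a\<^sup>2" "a\<^sup>2 - 1 < real m" by linarith+
    have m1: "m \<ge> 1" "1 / \<delta> \<le> real m" "a\<^sup>2 / 2 \<le> real m"
      using m aa a2 \<delta>(1) by linarith+
    let ?N = "m * t" and ?S = "(\<lambda>k. k * t) ` {..m}"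
    have N1: "?N \<ge> 1" using m1 t by simp
    have 1: "real t \<le> \<delta> * real ?N"
    proof -
      have "1 \<le> \<delta> * real m" using m1(2) \<delta>(1) by (simp add: divide_le_eq mult.commute)
      then have "1 * real t \<le> \<delta> * real m * real t" by (intro mult_right_mono) auto
      then show ?thesis by (simp add: mult.assoc)
    qed
    \<comment> \<open>Rounding \<open>a\<^sup>2\<close> down, not up, keeps
      \<open>sqrt (m * t)\<close> below the exceeded level \<open>a * sqrt t\<close>.\<close>
    have "sqrt (real m) \<le> a" using m(1) a2 by (intro real_le_lsqrt) auto
    then have 2: "1 * sqrt (real ?N) \<le> a * sqrt (real t)"
      by (simp add: real_sqrt_mult mult_right_mono)
    interpret R: prob_space "regen_given_epochs Pbulk Pfin ?N ?S"
      by (rule prob_space_regen_given_epochs[OF regular_epochs(1)[OF t]])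
    have "1 - (1 - q) ^ m \<le> R.prob (osc_exceeds ?N (real t) (a * sqrt (real t)))"
      unfolding q_def using a2 t by (intro regular_epochs_osc) auto
    also have "\<dots> \<le> R.prob (osc_exceeds ?N (\<delta> * real ?N) (1 * sqrt (real ?N)))"
      by (intro R.finite_measure_mono osc_exceeds_mono 1 2) simp
    also have "\<dots> \<le> \<epsilon>" by (rule \<delta>(2)[OF N1 regular_epochs(1)[OF t]])
    finally have "exp (- (\<kappa> / 2)) \<le> (1 - q) ^ m" by (simp add: \<epsilon>_def)
    also have "\<dots> \<le> exp (- q) ^ m"
      using exp_ge_add_one_self[of "- q"] by (intro power_mono) (auto simp: q_def)
    also have "\<dots> = exp (- (real m * q))" by (simp add: exp_of_nat_mult[symmetric])
    finally have "real m * q \<le> \<kappa> / 2" by simp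
    moreover have "a\<^sup>2 / 2 * q \<le> real m * q" using m1 by (intro mult_right_mono) (auto simp: q_def)
    ultimately have "q * a\<^sup>2 \<le> \<kappa>" by (simp add: mult.commute)
    then show ?thesis using a2 by (simp add: q_def le_divide_eq)
  qed
  then show "\<exists>a\<^sub>0>0. \<forall>a\<ge>a\<^sub>0. \<forall>t\<ge>1. measure (Pbulk t) (max_exceeds t (a * sqrt (real t))) \<le> \<kappa> / a\<^sup>2"
    by (intro exI[of _ a\<^sub>0]) (auto simp: a\<^sub>0_def)
qed

lemma regen_tight_iff:
  "(\<forall>p. (\<forall>N. regen_law N (p N)) \<longrightarrow> tight_C01 (\<lambda>N. regen_law_P (p N) Pbulk Pfin N))
    \<longleftrightarrow> tight_C01 Pbulk \<and> tight_C01 Pfin \<and> bulk_tail_vanishes"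
proof
  assume all: "\<forall>p. (\<forall>N. regen_law N (p N)) \<longrightarrow> tight_C01 (\<lambda>N. regen_law_P (p N) Pbulk Pfin N)"
  have "tight_C01 Pbulk"
  \<comment> \<open>With \<open>N\<close> as an epoch the only excursion is bulk; with
    \<open>{0}\<close> alone it is final.\<close>
  proof (rule tight_of_single_excursion[where S = "\<lambda>N. {0, N}"])
    show "tight_C01 (\<lambda>N. regen_law_P (return_pmf {0, N}) Pbulk Pfin N)"
      by (rule all[rule_format]) (simp add: regen_law_def)
    show "exc_law Pbulk Pfin N {0, N} 0 = Pbulk N" if "N \<ge> 1" for N
    proof -
      have "{u. (u = 0 \<or> u = N) \<and> 0 < u} = {N}" using that by auto
      then show ?thesis using that by (simp add: exc_law_def next_epoch_def)
    qed
  qed (auto simp: epoch_set_def bulk_prob bulk_sets)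
  moreover have "tight_C01 Pfin"
  proof (rule tight_of_single_excursion[where S = "\<lambda>N. {0}"])
    show "tight_C01 (\<lambda>N. regen_law_P (return_pmf {0}) Pbulk Pfin N)"
      by (rule all[rule_format]) (simp add: regen_law_def)
  qed (auto simp: epoch_set_def exc_law_def fin_prob fin_sets)
  moreover have bulk_tail_vanishes
    by (rule bulk_tail_necessary) (use all in blast)
  ultimately show "tight_C01 Pbulk \<and> tight_C01 Pfin \<and> bulk_tail_vanishes" by simp
next
  assume "tight_C01 Pbulk \<and> tight_C01 Pfin \<and> bulk_tail_vanishes"
  then show "\<forall>p. (\<forall>N. regen_law N (p N)) \<longrightarrow> tight_C01 (\<lambda>N. regen_law_P (p N) Pbulk Pfin N)"
    using regen_tight by simp
qed

end

theorem theorem3p1: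
  fixes Pbulk Pfin :: "nat \<Rightarrow> (nat \<Rightarrow> real) measure"
  assumes bulk_prob: "\<And>t. t \<ge> 1 \<Longrightarrow> prob_space (Pbulk t)"
      and bulk_sets: "\<And>t. t \<ge> 1 \<Longrightarrow> sets (Pbulk t) = sets (path_space t)"
      and bulk_ends: "\<And>t. t \<ge> 1 \<Longrightarrow> AE x in Pbulk t. x 0 = 0 \<and> x t = 0"
      and fin_prob: "\<And>t. t \<ge> 1 \<Longrightarrow> prob_space (Pfin t)"
      and fin_sets: "\<And>t. t \<ge> 1 \<Longrightarrow> sets (Pfin t) = sets (path_space t)"
      and fin_start: "\<And>t. t \<ge> 1 \<Longrightarrow> AE x in Pfin t. x 0 = 0"
  shows "(\<forall>p :: nat \<Rightarrow> nat set pmf. (\<forall>N. regen_law N (p N)) \<longrightarrow>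
            tight_C01 (\<lambda>N. regen_law_P (p N) Pbulk Pfin N))
    \<longleftrightarrow> (tight_C01 Pbulk \<and> tight_C01 Pfin \<and>
         (\<lambda>a::real. SUP t\<in>{1::nat..}. measure (Pbulk t)
             {x \<in> space (Pbulk t). (MAX i\<in>{..t}. \<bar>x i\<bar>) / sqrt (real t) > a})
           \<in> o[at_top](\<lambda>a. 1 / a\<^sup>2))"
proof -
  interpret excursion_laws Pbulk Pfin
    by (rule excursion_laws.intro) (fact assms)+
  show ?thesis
    unfolding bulk_tail_smallo_iff by (rule regen_tight_iff)
qed

end
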